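(* Let $I=[-1,1]$. If $\psi\in C^\infty(I)$ is real-valued, then $m_\psi(\lambda)=o(\log\lambda)$ as $\lambda\to\infty$. This bound is sharp in the following sense: for every integer $k\ge2$ there exist a real-valued $\psi\in C^\infty(I)$ and a sequence $\lambda_n\to\infty$ such that $$|m_\psi(\lambda_n)|\approx\frac{\log\lambda_n}{\log^{(k)}\lambda_n}$$ for all sufficiently large $n$.
   Context: For a real-valued $\psi\in C^1(I)$, $I=[-1,1]$, and $\lambda>0$, the Stein--Wainger oscillatory integral is $m_\psi(\lambda):=\mathrm{p.v.}\int_{-1}^{1}e^{i\lambda\psi(t)}\frac{dt}{t}=\lim_{\varepsilon\to0^+}\int_{\varepsilon\le|t|\le1}e^{i\lambda\psi(t)}\frac{dt}{t}$. $\log^{(k)}$ denotes the $k$-fold iterated logarithm. $X\approx Y$ means $cY\le X\le CY$ for some constants $c,C>0$ independent of $n$ (and of $\lambda_n$). *)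

theory Defs
  imports "HOL-Analysis.Analysis" "HOL-Library.Landau_Symbols"
begin

text \<open>
  Smoothness on \<open>I = [-1,1]\<close>: derivatives of all orders exist on \<open>I\<close>, one-sided at the end points.
  Only the values of \<open>\<psi>\<close> on \<open>I\<close> matter.
\<close>

definition smooth_on_I :: "(real \<Rightarrow> real) \<Rightarrow> bool" where
  "smooth_on_I \<psi> \<longleftrightarrow>
     (\<exists>D :: nat \<Rightarrow> real \<Rightarrow> real.
        (\<forall>t\<in>{-1..1}. D 0 t = \<psi> t) \<and>
        (\<forall>j. \<forall>t\<in>{-1..1}. (D j has_real_derivative D (Suc j) t) (at t within {-1..1})))"

definition truncated_SW :: "(real \<Rightarrow> real) \<Rightarrow> real \<Rightarrow> real \<Rightarrow> complex" where
  "truncated_SW \<psi> l \<epsilon> =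
     integral {t. \<epsilon> \<le> \<bar>t\<bar> \<and> \<bar>t\<bar> \<le> 1}
       (\<lambda>t. exp (\<i> * complex_of_real (l * \<psi> t)) / complex_of_real t)"

definition SW_integral :: "(real \<Rightarrow> real) \<Rightarrow> real \<Rightarrow> complex" where
  "SW_integral \<psi> l = Lim (at_right 0) (truncated_SW \<psi> l)"

text \<open>
  \<^const>\<open>Lim\<close> is meaningful here: for continuous \<open>\<psi>\<close> the truncated integrals exist, and if
  \<open>\<psi>\<close> is moreover differentiable at 0 (in particular if it is \<open>C\<^sup>1\<close>), they converge.
\<close>

lemma truncated_SW_reflect:
  fixes l :: real
  assumes cont: "continuous_on {-1..1} \<psi>" and e: "0 < \<epsilon>" "\<epsilon> \<le> 1"
  defines "f \<equiv> \<lambda>t. exp (\<i> * complex_of_real (l * \<psi> t))"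
  shows "((\<lambda>t. f t / complex_of_real t) has_integral
            integral {\<epsilon>..1} (\<lambda>t. (f t - f (-t)) / complex_of_real t))
           {t. \<epsilon> \<le> \<bar>t\<bar> \<and> \<bar>t\<bar> \<le> 1}"
proof -
  have cf: "continuous_on {-1..1} f"
    unfolding f_def by (intro continuous_intros cont)
  have cm: "continuous_on {\<epsilon>..1} (\<lambda>t. f (-t))"
    by (rule continuous_on_compose2[OF cf]) (use e in \<open>auto intro!: continuous_intros\<close>)
  have cp: "continuous_on {\<epsilon>..1} f"
    by (rule continuous_on_subset[OF cf]) (use e in auto)
  define A where "A = integral {\<epsilon>..1} (\<lambda>t. f t / complex_of_real t)"
  define B where "B = integral {\<epsilon>..1} (\<lambda>t. f (-t) / complex_of_real t)"
  have A: "((\<lambda>t. f t / complex_of_real t) has_integral A) {\<epsilon>..1}"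
    unfolding A_def
    by (intro integrable_integral integrable_continuous_real continuous_intros cp)
       (use e in auto)
  have B: "((\<lambda>t. f (-t) / complex_of_real t) has_integral B) {\<epsilon>..1}"
    unfolding B_def
    by (intro integrable_integral integrable_continuous_real continuous_intros cm)
       (use e in auto)
  have B': "((\<lambda>t. f t / complex_of_real t) has_integral - B) {-1..-\<epsilon>}"
    using has_integral_neg[OF has_integral_reflect_lemma_real[OF B]] by simp
  have "((\<lambda>t. f t / complex_of_real t) has_integral (A + - B)) ({\<epsilon>..1} \<union> {-1..-\<epsilon>})"
    by (rule has_integral_Un[OF A B']) (use e in \<open>auto\<close>)
  moreover have "{\<epsilon>..1} \<union> {-1..-\<epsilon>} = {t. \<epsilon> \<le> \<bar>t\<bar> \<and> \<bar>t\<bar> \<le> 1}"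
    using e by auto
  moreover have "A + - B = integral {\<epsilon>..1} (\<lambda>t. (f t - f (-t)) / complex_of_real t)"
    using integral_unique[OF has_integral_diff[OF A B]] by (simp add: diff_divide_distrib)
  ultimately show ?thesis by simp
qed

lemma SW_integral_tendsto:
  assumes cont: "continuous_on {-1..1} \<psi>" and der: "(\<psi> has_real_derivative d) (at 0)"
  shows "(truncated_SW \<psi> l \<longlongrightarrow> SW_integral \<psi> l) (at_right 0)"
proof -
  define f where "f = (\<lambda>t. exp (\<i> * complex_of_real (l * \<psi> t)))"
  have cf: "continuous_on {-1..1} f"
    unfolding f_def by (intro continuous_intros cont)
  from has_vector_derivative_of_real[OF der]
  have "((\<lambda>t. complex_of_real (\<psi> t)) has_vector_derivative complex_of_real d) (at 0)" .
  from has_vector_derivative_mult_right[OF this, of "\<i> * complex_of_real l"]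
  have "((\<lambda>t. \<i> * complex_of_real (l * \<psi> t)) has_vector_derivative
      \<i> * complex_of_real l * complex_of_real d) (at 0)"
    by (simp add: mult.assoc)
  from field_vector_diff_chain_at[OF this DERIV_exp]
  obtain w where w: "(f has_vector_derivative w) (at 0)"
    by (auto simp: f_def o_def)
  have neg: "(uminus has_vector_derivative (-1::real)) (at 0)"
    by (auto intro!: derivative_eq_intros)
  have w': "((\<lambda>t. f (-t)) has_vector_derivative - w) (at 0)"
    using vector_diff_chain_at[OF neg, of f w] w by (simp add: o_def)
  have "((\<lambda>t. f t - f (-t)) has_vector_derivative 2 * w) (at 0)"
    using has_vector_derivative_diff[OF w w'] by simp
  then have "((\<lambda>t. norm (f t - f (-t) - complex_of_real t * (2 * w)) / norm t) \<longlongrightarrow> 0) (at 0)"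
    by (simp add: has_vector_derivative_def has_derivative_iff_norm scaleR_conv_of_real)
  moreover have "\<forall>\<^sub>F t in at (0::real). norm (f t - f (-t) - complex_of_real t * (2 * w)) / norm t =
      norm ((f t - f (-t)) / complex_of_real t - 2 * w)"
  proof (unfold eventually_at_filter, rule always_eventually, intro allI impI)
    fix t :: real assume "t \<noteq> 0"
    then have "(f t - f (-t)) / complex_of_real t - 2 * w =
        (f t - f (-t) - complex_of_real t * (2 * w)) / complex_of_real t"
      by (simp add: field_simps)
    then show "norm (f t - f (-t) - complex_of_real t * (2 * w)) / norm t =
        norm ((f t - f (-t)) / complex_of_real t - 2 * w)"
      by (simp add: norm_divide)
  qed
  ultimately have "((\<lambda>t. norm ((f t - f (-t)) / complex_of_real t - 2 * w)) \<longlongrightarrow> 0) (at 0)"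
    by (rule Lim_transform_eventually)
  then have lim: "((\<lambda>t. (f t - f (-t)) / complex_of_real t) \<longlongrightarrow> 2 * w) (at 0)"
    by (simp add: tendsto_norm_zero_iff LIM_zero_iff)
  define g where "g = (\<lambda>t. if t = 0 then 2 * w else (f t - f (-t)) / complex_of_real t)"
  have cm: "continuous_on {-1..1} (\<lambda>t. f (-t))"
    by (rule continuous_on_compose2[OF cf]) (auto intro!: continuous_intros)
  have cg: "continuous_on {0..1} g"
    unfolding continuous_on_def
  proof
    fix x :: real assume x: "x \<in> {0..1}"
    show "(g \<longlongrightarrow> g x) (at x within {0..1})"
    proof (cases "x = 0")
      case True
      have "(g \<longlongrightarrow> 2 * w) (at 0)"
        by (rule Lim_transform_eventually[OF lim])
           (auto simp: g_def eventually_at_filter)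
      then show ?thesis
        using True by (auto simp: g_def intro: tendsto_within_subset)
    next
      case False
      have "((\<lambda>t. (f t - f (-t)) / complex_of_real t) \<longlongrightarrow> g x) (at x within {0..1})"
      proof -
        have "(f \<longlongrightarrow> f x) (at x within {0..1})"
             "((\<lambda>t. f (-t)) \<longlongrightarrow> f (-x)) (at x within {0..1})"
          using cf cm x
          by (auto simp: continuous_on_def intro: tendsto_within_subset[where S = "{-1..1}"])
        then show ?thesis
          using False by (auto simp: g_def intro!: tendsto_intros)
      qed
      moreover have "\<forall>\<^sub>F t in at x within {0..1}. (f t - f (-t)) / complex_of_real t = g t"
        unfolding eventually_at by (rule exI[of _ "\<bar>x\<bar>"]) (use False in \<open>auto simp: g_def dist_real_def\<close>)
      ultimately show ?thesis
        by (rule Lim_transform_eventually)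
    qed
  qed
  have "continuous_on {0..1} (\<lambda>\<epsilon>. integral {\<epsilon>..1} g)"
    by (rule indefinite_integral_continuous_1'[OF integrable_continuous_real[OF cg]])
  then have "((\<lambda>\<epsilon>. integral {\<epsilon>..1} g) \<longlongrightarrow> integral {0..1} g) (at 0 within {0..1})"
    by (auto simp: continuous_on_def)
  then have "((\<lambda>\<epsilon>. integral {\<epsilon>..1} g) \<longlongrightarrow> integral {0..1} g) (at_right 0)"
    by (simp add: at_within_Icc_at_right)
  moreover have "\<forall>\<^sub>F \<epsilon> in at_right 0. integral {\<epsilon>..1} g = truncated_SW \<psi> l \<epsilon>"
    unfolding eventually_at_right_field
  proof (intro exI[of _ 1] conjI allI impI)
    fix \<epsilon> :: real assume e: "0 < \<epsilon>" "\<epsilon> < 1"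
    have "truncated_SW \<psi> l \<epsilon> = integral {\<epsilon>..1} (\<lambda>t. (f t - f (-t)) / complex_of_real t)"
      unfolding truncated_SW_def f_def
      by (rule integral_unique, rule truncated_SW_reflect[OF cont]) (use e in auto)
    also have "\<dots> = integral {\<epsilon>..1} g"
      by (rule integral_cong) (use e in \<open>auto simp: g_def\<close>)
    finally show "integral {\<epsilon>..1} g = truncated_SW \<psi> l \<epsilon>" by simp
  qed simp
  ultimately have "(truncated_SW \<psi> l \<longlongrightarrow> integral {0..1} g) (at_right 0)"
    by (rule Lim_transform_eventually)
  then show ?thesis
    unfolding SW_integral_def using tendsto_Lim[OF trivial_limit_at_right_real] by metis
qed

corollary SW_integral_tendsto_smooth:
  assumes "smooth_on_I \<psi>"
  shows "(truncated_SW \<psi> l \<longlongrightarrow> SW_integral \<psi> l) (at_right 0)"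
proof -
  obtain D :: "nat \<Rightarrow> real \<Rightarrow> real" where D: "\<And>t. t \<in> {-1..1} \<Longrightarrow> D 0 t = \<psi> t"
    "\<And>t. t \<in> {-1..1} \<Longrightarrow> (D 0 has_real_derivative D 1 t) (at t within {-1..1})"
    using assms unfolding smooth_on_I_def One_nat_def by blast
  have der: "(\<psi> has_real_derivative D 1 t) (at t within {-1..1})" if "t \<in> {-1..1}" for t
    by (rule has_field_derivative_transform_within[OF D(2)[OF that] zero_less_one that])
       (simp add: D(1))
  show ?thesis
  proof (rule SW_integral_tendsto)
    show "continuous_on {-1..1} \<psi>"
      using der by (rule DERIV_continuous_on)
    show "(\<psi> has_real_derivative D 1 0) (at 0)"
      using der[of 0] at_within_Icc_at[of "-1" 0 "1::real"] by simp
  qed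
qed

end

theory Submission
  imports Defs
begin

text \<open>
  Write \<open>m(l)\<close> for \<open>SW_integral \<psi> l\<close>. Folding the negative half line onto the positive one makes
  \<open>m(l)\<close> the limit, as \<open>\<epsilon>\<close> tends to 0, of the difference of two integrals
  \<open>\<integral> exp(i l \<psi>(\<plusminus>t)) dt/t\<close> over \<open>[\<epsilon>, 1]\<close>. Each of them diverges like a logarithm, and everything
  rests on one description of such an integral. Suppose that \<open>\<psi>\<close> increases on \<open>(0, \<delta>]\<close>, that
  \<open>t \<psi>'(t)\<close> is increasing too and dominates \<open>\<psi>(t) - \<psi>(0)\<close> up to a constant, and let \<open>a\<close> be
  the point where the phase \<open>l (\<psi>(a) - \<psi>(0))\<close> has size about 1. Below \<open>a\<close> the phase is frozen, so \<open>[\<epsilon>, a]\<close> contributes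
  \<open>exp(i l \<psi>(0)) ln (a/\<epsilon>)\<close> up to a bounded error; above \<open>a\<close> one integration by parts against
  \<open>1/(t \<psi>'(t))\<close> shows that the oscillation leaves only a bounded contribution. This is
  \<open>norm_half_SW_sub_ln_le\<close>.

  For the upper bound look at the Taylor coefficients of \<open>\<psi>\<close> at 0. If the first one that does not
  vanish, beyond the constant, has order \<open>m\<close>, then \<open>\<psi>\<close> or \<open>-\<psi>\<close> is of the above kind on either
  side of 0, with the same transition point \<open>l powr (-1/m)\<close>. The logarithms cancel in the difference
  and \<open>m(l)\<close> is even bounded. If there is none, then \<open>\<psi>(t) - \<psi>(0) = O(t^N)\<close> for every \<open>N\<close>. The
  phase is now frozen at least up to \<open>l powr (-1/N)\<close>, and the absolute value of the integrand
  contributes no more than \<open>(ln l)/N\<close> beyond that point. Hence \<open>\<bar>m(l)\<bar>\<close> is at most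
  \<open>O(1) + 4 (ln l)/N\<close> for every \<open>N\<close>, which is \<open>o(ln l)\<close>.

  This argument loses nothing for a phase that vanishes on one side of 0 and decays, on the other
  side, only slightly faster than all powers: there the logarithms do not cancel, and \<open>m(l)\<close> is
  \<open>ln a + O(1)\<close> with \<open>a\<close> the transition point. Put \<open>x = x0 - ln t\<close> and \<open>\<psi>(t) = exp (- x L(x))\<close> for
  \<open>t > 0\<close>, where \<open>L\<close> is the \<open>(k-1)\<close>-fold logarithm: roughly \<open>t\<close> to the power
  \<open>L(ln (1/t))\<close>. With \<open>l = 1/\<psi>(a)\<close> one has
  \<open>ln l = x L(x)\<close> at \<open>x = x0 - ln a\<close>, and the \<open>k\<close>-fold logarithm of \<open>l\<close> is \<open>L(x L(x))\<close>, which lies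
  between \<open>L(x)\<close> and \<open>2 L(x)\<close>. So \<open>ln l\<close> divided by the \<open>k\<close>-fold logarithm is comparable with \<open>x\<close>,
  and hence with \<open>\<bar>ln a\<bar>\<close> and with \<open>\<bar>m(l)\<bar>\<close>.
\<close>

section \<open>Half-line integrals and their frozen and oscillating parts\<close>

definition half_SW :: "(real \<Rightarrow> real) \<Rightarrow> real \<Rightarrow> real \<Rightarrow> complex" where
  "half_SW \<psi> l \<epsilon> =
     integral {\<epsilon>..1} (\<lambda>t. exp (\<i> * complex_of_real (l * \<psi> t)) / complex_of_real t)"

lemma phase_integrable:
  assumes "continuous_on {a..b} \<psi>" "0 < a"
  shows "(\<lambda>t. exp (\<i> * complex_of_real (l * \<psi> t)) / complex_of_real t) integrable_on {a..b}"
  by (intro integrable_continuous_real continuous_intros assms) (use assms in auto)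

lemma inverse_has_integral_ln:
  fixes a b :: real
  assumes "0 < a" "a \<le> b"
  shows "((\<lambda>t. 1 / t) has_integral ln (b / a)) {a..b}"
proof -
  have "((\<lambda>t. 1 / t) has_integral (ln b - ln a)) {a..b}"
    by (rule fundamental_theorem_of_calculus[where f = ln])
       (use assms in \<open>auto intro!: derivative_eq_intros
          simp flip: has_real_derivative_iff_has_vector_derivative\<close>)
  then show ?thesis
    using assms by (simp add: ln_div)
qed

lemma norm_phase_integral_le:
  assumes "continuous_on {a..b} \<psi>" "0 < a" "a \<le> b"
  shows "norm (integral {a..b} (\<lambda>t. exp (\<i> * complex_of_real (l * \<psi> t)) / complex_of_real t))
         \<le> ln (b / a)"
proof -
  have "norm (integral {a..b} (\<lambda>t. exp (\<i> * complex_of_real (l * \<psi> t)) / complex_of_real t))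
      \<le> integral {a..b} (\<lambda>t. 1 / t)"
    by (rule integral_norm_bound_integral[OF phase_integrable[OF assms(1,2)]])
       (use assms inverse_has_integral_ln[OF assms(2,3)] in
          \<open>auto simp: norm_divide has_integral_iff\<close>)
  then show ?thesis
    using inverse_has_integral_ln[OF assms(2,3)] by (simp add: has_integral_iff)
qed

lemma cmod_exp_diff_le:
  fixes x y :: real
  shows "cmod (exp (\<i> * complex_of_real x) - exp (\<i> * complex_of_real y)) \<le> \<bar>x - y\<bar>"
proof -
  have "exp (\<i> * complex_of_real x) - exp (\<i> * complex_of_real y)
      = exp (\<i> * complex_of_real y) * (exp (\<i> * complex_of_real (x - y)) - 1)"
    by (simp add: algebra_simps flip: exp_add)
  then have "cmod (exp (\<i> * complex_of_real x) - exp (\<i> * complex_of_real y))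
      = 2 * \<bar>sin ((x - y) / 2)\<bar>"
    by (simp only: norm_mult dist_exp_i_1 norm_exp_i_times)
  also have "\<dots> \<le> \<bar>x - y\<bar>"
    using abs_sin_x_le_abs_x[of "(x - y) / 2"] by simp
  finally show ?thesis .
qed

lemma truncated_SW_eq_half_SW:
  assumes cont: "continuous_on {-1..1} \<psi>" and e: "0 < \<epsilon>" "\<epsilon> \<le> 1"
  shows "truncated_SW \<psi> l \<epsilon> = half_SW \<psi> l \<epsilon> - half_SW (\<lambda>t. \<psi> (- t)) l \<epsilon>"
proof -
  have "continuous_on {\<epsilon>..1} \<psi>" "continuous_on {\<epsilon>..1} (\<lambda>t. \<psi> (- t))"
    using e by (auto intro!: continuous_on_subset[OF cont] continuous_on_compose2[OF cont]
        continuous_intros)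
  note int = this[THEN phase_integrable, OF e(1)]
  show ?thesis
    unfolding truncated_SW_def half_SW_def
    using integral_unique[OF truncated_SW_reflect[OF cont e, of l]] integral_diff[OF int, of l l]
    by (simp add: diff_divide_distrib)
qed

lemma smooth_on_I_continuous:
  assumes "smooth_on_I \<psi>"
  shows "continuous_on {-1..1} \<psi>"
proof -
  obtain D :: "nat \<Rightarrow> real \<Rightarrow> real" where "\<And>t. t \<in> {-1..1} \<Longrightarrow> D 0 t = \<psi> t"
    "\<And>t. t \<in> {-1..1} \<Longrightarrow> (D 0 has_real_derivative D 1 t) (at t within {-1..1})"
    using assms unfolding smooth_on_I_def One_nat_def by blast
  then show ?thesis
    by (metis DERIV_continuous_on continuous_on_cong)
qed

text \<open>
  The divergent part \<open>z \<epsilon>\<close> common to the two half integrals cancels, and bounds that are uniform in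
  \<open>\<epsilon>\<close> pass to the principal value; \<open>w\<close> is the finite mismatch of the divergent parts.
\<close>
lemma norm_SW_integral_diff_le:
  assumes smooth: "smooth_on_I \<psi>" and a: "0 < a" "a \<le> 1"
    and B1: "\<And>\<epsilon>. 0 < \<epsilon> \<Longrightarrow> \<epsilon> < a \<Longrightarrow> norm (half_SW \<psi> l \<epsilon> - z \<epsilon>) \<le> B1"
    and B2: "\<And>\<epsilon>. 0 < \<epsilon> \<Longrightarrow> \<epsilon> < a \<Longrightarrow> norm (half_SW (\<lambda>t. \<psi> (- t)) l \<epsilon> - (z \<epsilon> - w)) \<le> B2"
  shows "norm (SW_integral \<psi> l - w) \<le> B1 + B2"
proof (rule tendsto_upperbound)
  show "((\<lambda>\<epsilon>. norm (truncated_SW \<psi> l \<epsilon> - w)) \<longlongrightarrow> norm (SW_integral \<psi> l - w)) (at_right 0)"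
    by (intro tendsto_intros SW_integral_tendsto_smooth smooth)
  show "\<forall>\<^sub>F \<epsilon> in at_right 0. norm (truncated_SW \<psi> l \<epsilon> - w) \<le> B1 + B2"
    unfolding eventually_at_right_field
  proof (intro exI[of _ a] conjI allI impI a)
    fix \<epsilon> assume e: "0 < \<epsilon>" "\<epsilon> < a"
    have "truncated_SW \<psi> l \<epsilon> - w
        = (half_SW \<psi> l \<epsilon> - z \<epsilon>) - (half_SW (\<lambda>t. \<psi> (- t)) l \<epsilon> - (z \<epsilon> - w))"
      using truncated_SW_eq_half_SW[OF smooth_on_I_continuous[OF smooth], of \<epsilon> l] e a by simp
    then show "norm (truncated_SW \<psi> l \<epsilon> - w) \<le> B1 + B2"
      using norm_triangle_ineq4 B1[OF e] B2[OF e] by (metis add_mono order_trans)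
  qed
qed simp

text \<open>
  Since \<open>exp(i l \<psi>)\<close> has derivative \<open>i l p exp(i l \<psi>)\<close>, the integrand is \<open>u/(i l)\<close> times that
  derivative, with \<open>u = 1/(t p)\<close>. Integrating by parts leaves two boundary terms and the integral of
  \<open>u'\<close>. The last hypothesis says that \<open>t p\<close> is increasing, so \<open>u\<close> is monotone and the total variation
  of \<open>u\<close> is again a boundary term.
\<close>
lemma first_derivative_test:
  assumes ab: "0 < a" "a \<le> b" and l: "l \<noteq> 0"
    and d1: "\<And>t. t \<in> {a..b} \<Longrightarrow> (\<psi> has_real_derivative p t) (at t)"
    and d2: "\<And>t. t \<in> {a..b} \<Longrightarrow> (p has_real_derivative q t) (at t)"
    and pos: "\<And>t. t \<in> {a..b} \<Longrightarrow> 0 < p t"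
    and mono: "\<And>t. t \<in> {a..b} \<Longrightarrow> 0 \<le> p t + t * q t"
  shows "norm (integral {a..b} (\<lambda>t. exp (\<i> * complex_of_real (l * \<psi> t)) / complex_of_real t))
         \<le> 2 / (\<bar>l\<bar> * (a * p a))"
proof -
  define e where "e t = exp (\<i> * complex_of_real (l * \<psi> t))" for t
  define u where "u t = 1 / (t * p t)" for t
  define u' where "u' t = - (p t + t * q t) / (t * p t)\<^sup>2" for t
  define G where "G t = e t * (complex_of_real (u t) / (\<i> * l))" for t
  have du: "(u has_real_derivative u' t) (at t)" if "t \<in> {a..b}" for t
    unfolding u_def u'_def
    by (rule derivative_eq_intros d2[OF that] refl)+
       (use ab that pos[OF that] in \<open>auto simp: power2_eq_square\<close>)
  have de: "(e has_vector_derivative e t * (\<i> * of_real (l * p t))) (at t)"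
    if "t \<in> {a..b}" for t
  proof -
    have "((\<lambda>t. complex_of_real (\<psi> t)) has_vector_derivative complex_of_real (p t)) (at t)"
      using has_vector_derivative_of_real[OF d1[OF that]] .
    from has_vector_derivative_mult_right[OF this, of "\<i> * complex_of_real l"]
    have "((\<lambda>t. \<i> * complex_of_real (l * \<psi> t)) has_vector_derivative
        \<i> * complex_of_real (l * p t)) (at t)"
      by (simp add: mult.assoc)
    from field_vector_diff_chain_at[OF this DERIV_exp]
    show ?thesis
      by (simp add: e_def [abs_def] o_def mult_ac)
  qed
  have "((\<lambda>t. e t * (complex_of_real (u' t) / (\<i> * l))
        + e t * (\<i> * of_real (l * p t)) * (complex_of_real (u t) / (\<i> * l)))
      has_integral (G b - G a)) {a..b}"
    unfolding G_def
    by (rule fundamental_theorem_of_calculus[OF ab(2) has_vector_derivative_at_within])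
       (intro has_vector_derivative_mult de has_vector_derivative_divide
        has_vector_derivative_of_real du)
  then have FTC: "((\<lambda>t. e t * (complex_of_real (u' t) / (\<i> * l)) + e t / complex_of_real t)
      has_integral (G b - G a)) {a..b}"
    by (rule has_integral_eq[rotated])
       (use ab l in \<open>auto simp: u_def field_simps dest!: pos[OF atLeastAtMost_iff[THEN iffD2], OF conjI]\<close>)
  have c\<psi>: "continuous_on {a..b} \<psi>"
    by (rule DERIV_continuous_on) (use d1 has_field_derivative_at_within in blast)
  have "((\<lambda>t. e t / complex_of_real t) has_integral integral {a..b} (\<lambda>t. e t / complex_of_real t)) {a..b}"
    unfolding e_def by (intro integrable_integral phase_integrable c\<psi> ab)
  from has_integral_diff[OF FTC this]
  have R: "((\<lambda>t. e t * (complex_of_real (u' t) / (\<i> * l))) has_integral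
      (G b - G a - integral {a..b} (\<lambda>t. e t / complex_of_real t))) {a..b}"
    by simp
  have "((\<lambda>t. - (u' t / \<bar>l\<bar>)) has_integral - (u b / \<bar>l\<bar> - u a / \<bar>l\<bar>)) {a..b}"
    by (rule has_integral_neg[OF fundamental_theorem_of_calculus[OF ab(2)
          has_vector_derivative_at_within[OF has_vector_derivative_divide]]])
       (auto intro: du simp flip: has_real_derivative_iff_has_vector_derivative)
  then have U: "((\<lambda>t. - (u' t / \<bar>l\<bar>)) has_integral (u a - u b) / \<bar>l\<bar>) {a..b}"
    by (simp add: diff_divide_distrib)
  have u'neg: "u' t \<le> 0" if "t \<in> {a..b}" for t
    using mono[OF that] by (simp add: u'_def divide_nonpos_nonneg)
  have ne: "norm (e t) = 1" for t
    by (simp add: e_def)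
  have "norm (e t * (complex_of_real (u' t) / (\<i> * l))) \<le> - (u' t / \<bar>l\<bar>)"
    if "t \<in> {a..b}" for t
    using u'neg[OF that] by (simp add: norm_mult norm_divide ne)
  then have "norm (G b - G a - integral {a..b} (\<lambda>t. e t / complex_of_real t)) \<le> (u a - u b) / \<bar>l\<bar>"
    using integral_norm_bound_integral[OF has_integral_integrable[OF R] has_integral_integrable[OF U]]
    unfolding integral_unique[OF R] integral_unique[OF U] by blast
  moreover have "norm (G t) = u t / \<bar>l\<bar>" if "t \<in> {a..b}" for t
    using pos[OF that] ab that by (simp add: G_def ne norm_mult norm_divide u_def)
  then have "norm (G a) = u a / \<bar>l\<bar>" "norm (G b) = u b / \<bar>l\<bar>"
    using ab by auto
  ultimately have "norm (integral {a..b} (\<lambda>t. e t / complex_of_real t))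
      \<le> u a / \<bar>l\<bar> + u b / \<bar>l\<bar> + (u a - u b) / \<bar>l\<bar>"
    using norm_triangle_ineq4[of "G b - G a" "G b - G a - integral {a..b} (\<lambda>t. e t / complex_of_real t)"]
      norm_triangle_ineq4[of "G b" "G a"] by simp
  then show ?thesis
    by (simp add: e_def u_def diff_divide_distrib mult_ac)
qed

text \<open>
  Where \<open>\<psi>\<close> stays close to a constant \<open>c\<close> the phase may be frozen at \<open>c\<close>. The error in the integrand
  is at most \<open>\<bar>l\<bar> \<bar>\<psi> t - c\<bar> / t\<close>, and a bound for it whose primitive \<open>H\<close> is known gets integrated.
\<close>
lemma norm_phase_integral_sub_ln_le:
  assumes cont: "continuous_on {\<epsilon>..a} \<psi>" and e: "0 < \<epsilon>" "\<epsilon> \<le> a"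
    and H: "\<And>t. t \<in> {\<epsilon>..a} \<Longrightarrow> (H has_real_derivative h t) (at t)"
    and bd: "\<And>t. t \<in> {\<epsilon>..a} \<Longrightarrow> \<bar>\<psi> t - c\<bar> \<le> t * h t"
  shows "norm (integral {\<epsilon>..a} (\<lambda>t. exp (\<i> * complex_of_real (l * \<psi> t)) / complex_of_real t)
           - exp (\<i> * complex_of_real (l * c)) * complex_of_real (ln (a / \<epsilon>)))
         \<le> \<bar>l\<bar> * (H a - H \<epsilon>)"
proof -
  let ?f = "\<lambda>t. exp (\<i> * complex_of_real (l * \<psi> t)) / complex_of_real t"
  let ?z = "exp (\<i> * complex_of_real (l * c))"
  have "((\<lambda>t. complex_of_real (1 / t)) has_integral complex_of_real (ln (a / \<epsilon>))) {\<epsilon>..a}"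
    using has_integral_linear[OF inverse_has_integral_ln[of \<epsilon> a]
        bounded_linear_of_real[where 'a = complex]] e
    by (simp add: o_def)
  from has_integral_mult_right[OF this, of ?z]
  have z: "((\<lambda>t. ?z / complex_of_real t) has_integral ?z * complex_of_real (ln (a / \<epsilon>))) {\<epsilon>..a}"
    by simp
  have f: "(?f has_integral integral {\<epsilon>..a} ?f) {\<epsilon>..a}"
    by (intro integrable_integral phase_integrable cont e)
  have h: "((\<lambda>t. \<bar>l\<bar> * h t) has_integral (\<bar>l\<bar> * H a - \<bar>l\<bar> * H \<epsilon>)) {\<epsilon>..a}"
    by (rule fundamental_theorem_of_calculus[OF e(2) has_vector_derivative_at_within])
       (auto intro!: DERIV_cmult H simp flip: has_real_derivative_iff_has_vector_derivative)
  have "norm (integral {\<epsilon>..a} ?f - ?z * complex_of_real (ln (a / \<epsilon>)))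
      = norm (integral {\<epsilon>..a} (\<lambda>t. ?f t - ?z / complex_of_real t))"
    using integral_unique[OF has_integral_diff[OF f z]] by simp
  also have "\<dots> \<le> integral {\<epsilon>..a} (\<lambda>t. \<bar>l\<bar> * h t)"
  proof (rule integral_norm_bound_integral)
    show "(\<lambda>t. ?f t - ?z / complex_of_real t) integrable_on {\<epsilon>..a}"
      using has_integral_diff[OF f z] by blast
    show "(\<lambda>t. \<bar>l\<bar> * h t) integrable_on {\<epsilon>..a}"
      using h by blast
    fix t assume t: "t \<in> {\<epsilon>..a}"
    then have "0 < t"
      using e by auto
    then have "norm (?f t - ?z / complex_of_real t)
        = norm (exp (\<i> * complex_of_real (l * \<psi> t)) - ?z) / t"
      by (simp add: norm_divide flip: diff_divide_distrib)
    also have "\<dots> \<le> \<bar>l * \<psi> t - l * c\<bar> / t"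
      using \<open>0 < t\<close> by (intro divide_right_mono cmod_exp_diff_le) auto
    also have "\<bar>l * \<psi> t - l * c\<bar> = \<bar>l\<bar> * \<bar>\<psi> t - c\<bar>"
      by (simp flip: abs_mult right_diff_distrib)
    also have "\<dots> / t \<le> \<bar>l\<bar> * (t * h t) / t"
      using \<open>0 < t\<close> bd[OF t] by (intro divide_right_mono mult_left_mono) auto
    finally show "norm (?f t - ?z / complex_of_real t) \<le> \<bar>l\<bar> * h t"
      using \<open>0 < t\<close> by simp
  qed
  also have "\<dots> = \<bar>l\<bar> * (H a - H \<epsilon>)"
    using integral_unique[OF h] by (simp add: right_diff_distrib)
  finally show ?thesis .
qed

text \<open>
  The three error terms belong to the intervals \<open>[\<epsilon>, a]\<close>, \<open>[a, \<delta>]\<close> and \<open>[\<delta>, 1]\<close>: frozen phase,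
  oscillation, and trivial estimate. The bound of \<open>\<psi> t - \<psi> 0\<close> by \<open>K t p(t)\<close> is used in both of the
  first two: it makes the freezing error the increment of \<open>K \<psi>\<close>, and it turns the quantity
  \<open>a p(a)\<close> of the integration by parts into \<open>b\<close>. The estimate is useful when the phase increment
  \<open>b\<close> at \<open>a\<close> is neither large nor small. The sign of \<open>l\<close> is arbitrary, so that decreasing phases are
  covered by changing the signs of both \<open>l\<close> and \<open>\<psi>\<close>.
\<close>
lemma norm_half_SW_sub_ln_le:
  assumes cont: "continuous_on {0..1} \<psi>" and l: "l \<noteq> 0" and a: "0 < a" "a \<le> \<delta>" "\<delta> \<le> 1"
    and d1: "\<And>t. 0 < t \<Longrightarrow> t \<le> \<delta> \<Longrightarrow> (\<psi> has_real_derivative p t) (at t)"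
    and d2: "\<And>t. 0 < t \<Longrightarrow> t \<le> \<delta> \<Longrightarrow> (p has_real_derivative q t) (at t)"
    and pos: "\<And>t. 0 < t \<Longrightarrow> t \<le> \<delta> \<Longrightarrow> 0 < p t"
    and mono: "\<And>t. 0 < t \<Longrightarrow> t \<le> \<delta> \<Longrightarrow> 0 \<le> p t + t * q t"
    and bd: "\<And>t. 0 < t \<Longrightarrow> t \<le> \<delta> \<Longrightarrow> \<psi> 0 \<le> \<psi> t \<and> \<psi> t - \<psi> 0 \<le> K * (t * p t)"
    and b: "b = \<bar>l\<bar> * (\<psi> a - \<psi> 0)" "0 < b" and K: "0 \<le> K" and e: "0 < \<epsilon>" "\<epsilon> < a"
  shows "norm (half_SW \<psi> l \<epsilon> - exp (\<i> * complex_of_real (l * \<psi> 0)) * complex_of_real (ln (a / \<epsilon>)))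
         \<le> K * b + 2 * K / b + ln (1 / \<delta>)"
proof -
  let ?f = "\<lambda>t. exp (\<i> * complex_of_real (l * \<psi> t)) / complex_of_real t"
  let ?z = "exp (\<i> * complex_of_real (l * \<psi> 0))"
  have c: "continuous_on {x..y} \<psi>" if "0 \<le> x" "y \<le> 1" for x y
    by (rule continuous_on_subset[OF cont]) (use that in auto)
  have int: "?f integrable_on {x..y}" if "0 < x" "y \<le> 1" for x y
    by (rule phase_integrable) (use that in \<open>auto intro: c\<close>)
  have split: "half_SW \<psi> l \<epsilon> = integral {\<epsilon>..a} ?f + (integral {a..\<delta>} ?f + integral {\<delta>..1} ?f)"
    unfolding half_SW_def
    using a e Henstock_Kurzweil_Integration.integral_combine[where f = ?f and a = \<epsilon> and c = a and b = 1]
      Henstock_Kurzweil_Integration.integral_combine[where f = ?f and a = a and c = \<delta> and b = 1] int[of \<epsilon> 1] int[of a 1]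
    by simp
  have near: "norm (integral {\<epsilon>..a} ?f - ?z * complex_of_real (ln (a / \<epsilon>))) \<le> K * b"
  proof -
    have "norm (integral {\<epsilon>..a} ?f - ?z * complex_of_real (ln (a / \<epsilon>)))
        \<le> \<bar>l\<bar> * (K * \<psi> a - K * \<psi> \<epsilon>)"
    proof (rule norm_phase_integral_sub_ln_le[where h = "\<lambda>t. K * p t"])
      fix t assume "t \<in> {\<epsilon>..a}"
      then have t: "0 < t" "t \<le> \<delta>"
        using e a by auto
      show "((\<lambda>t. K * \<psi> t) has_real_derivative K * p t) (at t)"
        by (rule DERIV_cmult[OF d1[OF t]])
      show "\<bar>\<psi> t - \<psi> 0\<bar> \<le> t * (K * p t)"
        using bd[OF t] by (simp add: mult_ac)
    qed (use a e in \<open>auto intro: c\<close>)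
    also have "\<dots> \<le> \<bar>l\<bar> * (K * \<psi> a - K * \<psi> 0)"
      using bd[of \<epsilon>] e a K by (intro mult_left_mono diff_left_mono) auto
    finally show ?thesis
      by (simp add: b algebra_simps)
  qed
  have "norm (integral {a..\<delta>} ?f) \<le> 2 / (\<bar>l\<bar> * (a * p a))"
    by (rule first_derivative_test[OF a(1,2) l, where q = q]) (use a d1 d2 pos mono in auto)
  also have "\<dots> \<le> 2 * K / b"
  proof -
    have p: "0 < \<bar>l\<bar> * (a * p a)"
      using l a pos[of a] by simp
    have "b \<le> K * (\<bar>l\<bar> * (a * p a))"
      using mult_left_mono[of _ _ "\<bar>l\<bar>", OF conjunct2[OF bd[of a]]] a by (simp add: b mult_ac)
    then have "1 / (\<bar>l\<bar> * (a * p a)) \<le> K / b"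
      using p b(2) by (simp add: divide_simps)
    then show ?thesis by simp
  qed
  finally have far: "norm (integral {a..\<delta>} ?f) \<le> 2 * K / b" .
  have last: "norm (integral {\<delta>..1} ?f) \<le> ln (1 / \<delta>)"
    using norm_phase_integral_le[OF c] a by auto
  have eq: "half_SW \<psi> l \<epsilon> - ?z * complex_of_real (ln (a / \<epsilon>))
      = (integral {\<epsilon>..a} ?f - ?z * complex_of_real (ln (a / \<epsilon>)))
        + integral {a..\<delta>} ?f + integral {\<delta>..1} ?f"
    by (simp only: split) simp
  show ?thesis
    unfolding eq by (rule norm_triangle_mono[OF norm_triangle_mono[OF near far] last])
qed

section \<open>The upper bound for smooth phases\<close>

text \<open>
  \<open>D j\<close> plays the role of the \<open>j\<close>-th derivative of \<open>D 0\<close>. Keeping the whole family as an object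
  avoids iterating a derivative operator, which would have to be one-sided at the end points.
\<close>
definition derivative_chain :: "(nat \<Rightarrow> real \<Rightarrow> real) \<Rightarrow> bool" where
  "derivative_chain D \<longleftrightarrow>
     (\<forall>j. \<forall>t\<in>{-1..1}. (D j has_real_derivative D (Suc j) t) (at t within {-1..1}))"

lemma derivative_chain_DERIV:
  assumes "derivative_chain D" "\<bar>t\<bar> < 1"
  shows "(D j has_real_derivative D (Suc j) t) (at t)"
proof -
  have "(D j has_real_derivative D (Suc j) t) (at t within {-1..1})"
    using assms unfolding derivative_chain_def by (simp add: abs_less_iff less_imp_le)
  then show ?thesis
    using assms(2) by (simp add: at_within_Icc_at abs_less_iff)
qed

lemma derivative_chain_continuous:
  assumes "derivative_chain D"
  shows "continuous_on {-1..1} (D j)"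
  using assms by (auto simp: derivative_chain_def intro: DERIV_continuous_on)

lemma derivative_chain_reflect:
  assumes "derivative_chain D"
  shows "derivative_chain (\<lambda>j t. (-1) ^ j * D j (- t))"
  unfolding derivative_chain_def
proof (intro allI ballI)
  fix j and t :: real assume t: "t \<in> {-1..1}"
  have "(D j has_real_derivative D (Suc j) (- t)) (at (- t) within uminus ` {-1..1})"
    using assms t by (auto simp: derivative_chain_def)
  moreover have "(uminus has_real_derivative - 1) (at t within {-1..1})"
    by (auto intro!: derivative_eq_intros)
  ultimately have "((\<lambda>t. D j (- t)) has_real_derivative - D (Suc j) (- t)) (at t within {-1..1})"
    using DERIV_image_chain[of "D j" _ uminus t "{-1..1}" "- 1"] by (simp add: o_def)
  from DERIV_cmult[OF this, of "(-1) ^ j"]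
  show "((\<lambda>t. (-1) ^ j * D j (- t)) has_real_derivative (-1) ^ Suc j * D (Suc j) (- t))
      (at t within {-1..1})"
    by simp
qed

text \<open>
  Taylor's formula at 0 for \<open>D i\<close>, in the case where only the first and the last term survive. The
  conditional covers \<open>i = n\<close>, where the first term is itself the remainder.
\<close>
lemma Maclaurin_derivative_chain:
  assumes D: "derivative_chain D" and "i \<le> n" and z: "\<And>j. i < j \<Longrightarrow> j < n \<Longrightarrow> D j 0 = 0"
    and t: "0 < t" "t < 1"
  shows "\<exists>s. 0 < s \<and> s \<le> t \<and>
    D i t = (if i = n then 0 else D i 0) + D n s / fact (n - i) * t ^ (n - i)"
proof -
  have "\<exists>s. 0 < s \<and> s \<le> t \<and> D i t =
      (\<Sum>m<n - i. D (i + m) 0 / fact m * t ^ m) + D (i + (n - i)) s / fact (n - i) * t ^ (n - i)"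
    by (rule Maclaurin2[OF t(1)])
       (use t in \<open>auto intro!: derivative_chain_DERIV[OF D, of _ "i + _", simplified add_Suc_right]\<close>)
  moreover have "(\<Sum>m<n - i. D (i + m) 0 / fact m * t ^ m) = (if i = n then 0 else D i 0)"
  proof (cases "i = n")
    case False
    then have "n - i = Suc (n - Suc i)"
      using \<open>i \<le> n\<close> by simp
    moreover have "(\<Sum>m<n - Suc i. D (i + Suc m) 0 / fact (Suc m) * t ^ Suc m) = 0"
      by (intro sum.neutral) (auto simp: z)
    ultimately show ?thesis
      using False by (simp only: sum.lessThan_Suc_shift) simp
  qed simp
  ultimately show ?thesis
    using \<open>i \<le> n\<close> by simp
qed

lemma mult_root_power_eq_1:
  fixes l :: real
  assumes "0 < l" "0 < n"
  shows "l * (l powr (- 1 / real n)) ^ n = 1"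
proof -
  have "(l powr (- 1 / real n)) ^ n = l powr (real n * (- 1 / real n))"
    using assms by (intro powr_power) auto
  then show ?thesis
    using assms by (simp add: powr_minus_divide)
qed

text \<open>
  The phase is frozen up to \<open>a = l powr (- 1 / N)\<close>, where \<open>l * a ^ N = 1\<close>. The integral over
  \<open>[a, 1]\<close> costs at most \<open>ln (1 / a) = ln l / N\<close>, and so does the replacement of \<open>ln (a / \<epsilon>)\<close> by
  \<open>ln (1 / \<epsilon>)\<close>. The
  constant \<open>C\<close> depends on \<open>N\<close>, but not on \<open>l\<close>.
\<close>
lemma half_SW_infinite_order:
  assumes D: "derivative_chain D" and flat: "\<And>j. 0 < j \<Longrightarrow> D j 0 = 0" and N: "0 < N"
  shows "\<exists>C. \<forall>l>1. \<forall>\<epsilon>. 0 < \<epsilon> \<and> \<epsilon> < l powr (- 1 / real N) \<longrightarrow>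
    norm (half_SW (D 0) l \<epsilon> - exp (\<i> * complex_of_real (l * D 0 0)) * complex_of_real (ln (1 / \<epsilon>)))
      \<le> C + 2 * ln l / real N"
proof -
  have "bounded (D N ` {-1..1})"
    by (intro compact_imp_bounded compact_continuous_image derivative_chain_continuous D) auto
  then obtain M where M: "0 < M" "\<And>t. t \<in> {-1..1} \<Longrightarrow> \<bar>D N t\<bar> \<le> M"
    by (auto simp: bounded_pos)
  have Taylor: "\<bar>D 0 t - D 0 0\<bar> \<le> M * t ^ N" if t: "0 < t" "t < 1" for t
  proof -
    obtain s where s: "0 < s" "s \<le> t" "D 0 t = D 0 0 + D N s / fact N * t ^ N"
      using Maclaurin_derivative_chain[OF D, of 0 N t] flat N t by auto
    have "\<bar>D N s / fact N\<bar> \<le> M / 1"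
      unfolding abs_divide by (rule frac_le) (use M(1) M(2)[of s] s t in auto)
    then have "\<bar>D N s / fact N\<bar> * t ^ N \<le> M * t ^ N"
      using t by (intro mult_right_mono) auto
    then show ?thesis
      using s t by (simp add: abs_mult)
  qed
  show ?thesis
  proof (intro exI[of _ "M / N"] allI impI)
    fix l \<epsilon> :: real
    assume l: "1 < l" and e: "0 < \<epsilon> \<and> \<epsilon> < l powr (- 1 / real N)"
    define a where "a = l powr (- 1 / real N)"
    have a: "0 < a" "a < 1" and lna: "ln (1 / a) = ln l / N"
      using l N by (auto simp: a_def powr_less_one ln_div)
    have la: "l * a ^ N = 1"
      using mult_root_power_eq_1[of l N] l N by (simp add: a_def)
    let ?f = "\<lambda>t. exp (\<i> * complex_of_real (l * D 0 t)) / complex_of_real t"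
    let ?z = "exp (\<i> * complex_of_real (l * D 0 0))"
    have c: "continuous_on {x..y} (D 0)" if "0 \<le> x" "y \<le> 1" for x y
      by (rule continuous_on_subset[OF derivative_chain_continuous[OF D]]) (use that in auto)
    have int: "?f integrable_on {x..y}" if "0 < x" "y \<le> 1" for x y
      by (rule phase_integrable) (use that in \<open>auto intro: c\<close>)
    have split: "half_SW (D 0) l \<epsilon> = integral {\<epsilon>..a} ?f + integral {a..1} ?f"
      unfolding half_SW_def
      using a e int[of \<epsilon> 1]
        Henstock_Kurzweil_Integration.integral_combine[where f = ?f and a = \<epsilon> and c = a and b = 1]
      by (simp add: a_def)
    have lns: "ln (1 / \<epsilon>) = ln (a / \<epsilon>) + ln (1 / a)"
      using a e by (simp add: ln_div)
    have near: "norm (integral {\<epsilon>..a} ?f - ?z * complex_of_real (ln (a / \<epsilon>))) \<le> M / N"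
    proof -
      have "norm (integral {\<epsilon>..a} ?f - ?z * complex_of_real (ln (a / \<epsilon>)))
          \<le> \<bar>l\<bar> * (M / N * a ^ N - M / N * \<epsilon> ^ N)"
      proof (rule norm_phase_integral_sub_ln_le[where h = "\<lambda>t. M * t ^ (N - 1)"])
        fix t assume "t \<in> {\<epsilon>..a}"
        then have t: "0 < t" "t < 1"
          using e a by auto
        show "((\<lambda>t. M / N * t ^ N) has_real_derivative M * t ^ (N - 1)) (at t)"
          using N by (auto intro!: derivative_eq_intros)
        have "t * t ^ (N - 1) = t ^ N"
          using N by (metis power_eq_if neq0_conv)
        then show "\<bar>D 0 t - D 0 0\<bar> \<le> t * (M * t ^ (N - 1))"
          using Taylor[OF t] by (metis mult.left_commute)
      qed (use a e in \<open>auto simp: a_def intro: c\<close>)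
      also have "\<dots> \<le> \<bar>l\<bar> * (M / N * a ^ N)"
        using M(1) e by (intro mult_left_mono) auto
      also have "\<dots> = M / N * (l * a ^ N)"
        using l by simp
      finally show ?thesis
        by (simp add: la)
    qed
    have far: "norm (integral {a..1} ?f) \<le> ln l / N"
      using norm_phase_integral_le[OF c, of a 1 l] a lna by simp
    have main: "norm (?z * complex_of_real (ln (1 / a))) \<le> ln l / N"
      unfolding norm_mult norm_exp_i_times lna norm_of_real using l by simp
    have eq: "half_SW (D 0) l \<epsilon> - ?z * complex_of_real (ln (1 / \<epsilon>))
        = (integral {\<epsilon>..a} ?f - ?z * complex_of_real (ln (a / \<epsilon>)))
          + integral {a..1} ?f - ?z * complex_of_real (ln (1 / a))"
      by (simp only: split lns of_real_add distrib_left) simp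
    show "norm (half_SW (D 0) l \<epsilon> - ?z * complex_of_real (ln (1 / \<epsilon>))) \<le> M / N + 2 * ln l / N"
      unfolding eq
      using norm_triangle_ineq4[of "(integral {\<epsilon>..a} ?f - ?z * complex_of_real (ln (a / \<epsilon>)))
          + integral {a..1} ?f" "?z * complex_of_real (ln (1 / a))"]
        norm_triangle_mono[OF near far] main by linarith
  qed
qed

text \<open>
  Near 0 every \<open>D i\<close> with \<open>1 \<le> i \<le> m\<close> inherits from \<open>D m\<close> a positive lower bound of order
  \<open>t ^ (m - i)\<close>, so \<open>norm_half_SW_sub_ln_le\<close> applies with \<open>a = l powr (- 1 / m)\<close>. Both signs \<open>s\<close> of
  the frequency are treated at once, because a negative leading coefficient will be reduced to a
  positive one by passing to \<open>- D\<close> and \<open>- l\<close>.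
\<close>
lemma half_SW_finite_order_pos:
  assumes D: "derivative_chain D" and m: "0 < m" "\<And>j. 0 < j \<Longrightarrow> j < m \<Longrightarrow> D j 0 = 0" "0 < D m 0"
  shows "\<exists>B. \<forall>\<^sub>F l in at_top. \<forall>s. \<bar>s\<bar> = 1 \<longrightarrow> (\<forall>\<epsilon>. 0 < \<epsilon> \<and> \<epsilon> < l powr (- 1 / real m) \<longrightarrow>
    norm (half_SW (D 0) (s * l) \<epsilon> - exp (\<i> * complex_of_real (s * l * D 0 0)) *
      complex_of_real (ln (l powr (- 1 / real m) / \<epsilon>))) \<le> B)"
proof -
  define A where "A = D m 0 / 2"
  have A: "0 < A"
    using m by (simp add: A_def)
  have cont: "isCont (D j) 0" for j
    using DERIV_isCont[OF derivative_chain_DERIV[OF D]] by simp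
  have "\<forall>\<^sub>F t in at 0. A < D m t"
    by (rule order_tendstoD(1)[OF cont[unfolded isCont_def]]) (use A in \<open>simp add: A_def\<close>)
  moreover have "\<forall>\<^sub>F t in at 0. D m t < 3 * A"
    by (rule order_tendstoD(2)[OF cont[unfolded isCont_def]]) (use A in \<open>simp add: A_def\<close>)
  \<comment> \<open>For \<open>m = 1\<close> the term \<open>t * D 2 t\<close> has no definite sign near 0, but it is smaller than \<open>D 1 t\<close>.\<close>
  moreover have "\<forall>\<^sub>F t in at 0. - A < t * D 2 t"
  proof (rule order_tendstoD(1))
    show "((\<lambda>t. t * D 2 t) \<longlongrightarrow> 0 * D 2 0) (at 0)"
      by (intro tendsto_intros cont[unfolded isCont_def])
  qed (use A in simp)
  ultimately have "\<forall>\<^sub>F t in at 0. A < D m t \<and> D m t < 3 * A \<and> - A < t * D 2 t"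
    by eventually_elim simp
  then obtain d where d: "0 < d"
    "\<And>t. t \<noteq> 0 \<Longrightarrow> \<bar>t\<bar> < d \<Longrightarrow> A < D m t \<and> D m t < 3 * A \<and> - A < t * D 2 t"
    by (auto simp: eventually_at dist_real_def)
  define \<delta> where "\<delta> = min (d / 2) (1 / 2)"
  have \<delta>: "0 < \<delta>" "\<delta> < 1" "\<delta> < d"
    using d by (auto simp: \<delta>_def)
  have bnd: "A < D m t" "D m t < 3 * A" "- A < t * D 2 t" if "0 < t" "t \<le> \<delta>" for t
    using d(2)[of t] that \<delta> by auto
  have lower: "A / fact (m - i) * t ^ (m - i) \<le> D i t" if it: "0 < i" "i \<le> m" "0 < t" "t \<le> \<delta>" for i t
  proof -
    obtain s where s: "0 < s" "s \<le> t" "D i t = D m s / fact (m - i) * t ^ (m - i)"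
      using Maclaurin_derivative_chain[OF D it(2), of t] it m \<delta> by (auto split: if_splits)
    show ?thesis
      unfolding s(3) using bnd(1)[of s] s it
      by (intro mult_right_mono divide_right_mono) auto
  qed
  have zero: "A / fact m * t ^ m \<le> D 0 t - D 0 0" "D 0 t - D 0 0 \<le> 3 * A / fact m * t ^ m"
    if t: "0 < t" "t \<le> \<delta>" for t
  proof -
    obtain s where s: "0 < s" "s \<le> t" "D 0 t - D 0 0 = D m s / fact m * t ^ m"
      using Maclaurin_derivative_chain[OF D, of 0 m t] t m \<delta> by auto
    show "A / fact m * t ^ m \<le> D 0 t - D 0 0" "D 0 t - D 0 0 \<le> 3 * A / fact m * t ^ m"
      unfolding s(3) using bnd(1,2)[of s] s t
      by (auto intro!: mult_right_mono divide_right_mono)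
  qed
  define B where "B = 3 * (3 * A / fact m) + 2 * 3 / (A / fact m) + ln (1 / \<delta>)"
  have "((\<lambda>l. l powr (- 1 / real m)) \<longlongrightarrow> 0) at_top"
    by (rule tendsto_neg_powr) (use m filterlim_ident in auto)
  then have "\<forall>\<^sub>F l in at_top. l powr (- 1 / real m) < \<delta>"
    using \<delta>(1) by (rule order_tendstoD(2))
  moreover have "\<forall>\<^sub>F l in at_top. (0::real) < l"
    by (rule eventually_gt_at_top)
  ultimately show ?thesis
  proof (intro exI[of _ B], eventually_elim, intro allI impI)
    fix l s \<epsilon> :: real
    assume small: "l powr (- 1 / real m) < \<delta>" and l: "0 < l" and s: "\<bar>s\<bar> = 1"
      and e: "0 < \<epsilon> \<and> \<epsilon> < l powr (- 1 / real m)"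
    define a where "a = l powr (- 1 / real m)"
    have a: "0 < a" "a < \<delta>"
      using l small by (auto simp: a_def)
    have la: "l * a ^ m = 1"
      using mult_root_power_eq_1[of l m] l m by (simp add: a_def)
    define b where "b = \<bar>s * l\<bar> * (D 0 a - D 0 0)"
    have b': "b = l * (D 0 a - D 0 0)"
      using s l by (simp add: b_def abs_mult)
    have "l * (A / fact m * a ^ m) \<le> b" "b \<le> l * (3 * A / fact m * a ^ m)"
      unfolding b' by (rule mult_left_mono; use zero[of a] a l in simp)+
    moreover have "l * (x * a ^ m) = x" for x
      using la by (metis mult.left_commute mult.right_neutral)
    ultimately have b_lo: "A / fact m \<le> b" and b_hi: "b \<le> 3 * A / fact m"
      by metis+
    have b0: "0 < b"
      using b_lo A less_le_trans[of 0 "A / fact m" b] by simp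
    \<comment> \<open>\<open>K = 3\<close> is the ratio of the upper bound \<open>3 * A\<close> to the lower bound \<open>A\<close> of \<open>D m\<close> on \<open>(0, \<delta>]\<close>.\<close>
    have "norm (half_SW (D 0) (s * l) \<epsilon> - exp (\<i> * complex_of_real (s * l * D 0 0)) *
        complex_of_real (ln (a / \<epsilon>))) \<le> 3 * b + 2 * 3 / b + ln (1 / \<delta>)"
    proof (rule norm_half_SW_sub_ln_le[where p = "D 1" and q = "D 2" and K = 3])
      show "continuous_on {0..1} (D 0)"
        by (rule continuous_on_subset[OF derivative_chain_continuous[OF D]]) auto
      fix t assume t: "0 < t" "t \<le> \<delta>"
      show "(D 0 has_real_derivative D 1 t) (at t)" "(D 1 has_real_derivative D 2 t) (at t)"
        using derivative_chain_DERIV[OF D, of t 0] derivative_chain_DERIV[OF D, of t 1] t \<delta>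
        by (auto simp: numeral_2_eq_2)
      have D1: "A / fact (m - 1) * t ^ (m - 1) \<le> D 1 t"
        using lower[of 1 t] m t by simp
      moreover have "0 < A / fact (m - 1) * t ^ (m - 1)"
        using A t by simp
      ultimately show D1pos: "0 < D 1 t"
        by linarith
      show "0 \<le> D 1 t + t * D 2 t"
      proof (cases "m = 1")
        case True
        then show ?thesis
          using D1 bnd(3)[OF t] by simp
      next
        case False
        then have "A / fact (m - 2) * t ^ (m - 2) \<le> D 2 t"
          using lower[of 2 t] m t by simp
        moreover have "0 < A / fact (m - 2) * t ^ (m - 2)"
          using A t by simp
        ultimately show ?thesis
          using D1pos t by (simp add: less_imp_le add_nonneg_nonneg)
      qed
      have "3 * A / fact m * t ^ m = 3 * (t * (A / fact (m - 1) * t ^ (m - 1))) / m"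
        using m(1) by (cases m) (auto simp: field_simps)
      also have "\<dots> \<le> 3 * (t * (A / fact (m - 1) * t ^ (m - 1))) / 1"
        by (rule divide_left_mono) (use m A t in auto)
      also have "\<dots> \<le> 3 * (t * D 1 t)"
        using mult_left_mono[OF mult_left_mono[OF D1], of t 3] t by simp
      finally have "D 0 t - D 0 0 \<le> 3 * (t * D 1 t)"
        using zero(2)[OF t] by linarith
      moreover have "0 \<le> A / fact m * t ^ m"
        using A t by simp
      ultimately show "D 0 0 \<le> D 0 t \<and> D 0 t - D 0 0 \<le> 3 * (t * D 1 t)"
        using zero(1)[OF t] by linarith
    qed (use s l a \<delta> e b0 in \<open>auto simp: b_def a_def\<close>)
    also have "\<dots> \<le> B"
    proof -
      have "2 * 3 / b \<le> 2 * 3 / (A / fact m)"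
        by (rule divide_left_mono) (use b_lo b0 A in auto)
      then show ?thesis
        using b_hi by (simp add: B_def)
    qed
    finally show "norm (half_SW (D 0) (s * l) \<epsilon> - exp (\<i> * complex_of_real (s * l * D 0 0)) *
        complex_of_real (ln (l powr (- 1 / real m) / \<epsilon>))) \<le> B"
      by (simp add: a_def)
  qed
qed

lemma half_SW_finite_order:
  assumes D: "derivative_chain D" and m: "0 < m" "\<And>j. 0 < j \<Longrightarrow> j < m \<Longrightarrow> D j 0 = 0" "D m 0 \<noteq> 0"
  shows "\<exists>B. \<forall>\<^sub>F l in at_top. \<forall>\<epsilon>. 0 < \<epsilon> \<and> \<epsilon> < l powr (- 1 / real m) \<longrightarrow>
    norm (half_SW (D 0) l \<epsilon> - exp (\<i> * complex_of_real (l * D 0 0)) *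
      complex_of_real (ln (l powr (- 1 / real m) / \<epsilon>))) \<le> B"
proof (cases "0 < D m 0")
  case True
  from half_SW_finite_order_pos[OF D m(1,2) this] obtain B where
    "\<forall>\<^sub>F l in at_top. \<forall>s. \<bar>s\<bar> = 1 \<longrightarrow> (\<forall>\<epsilon>. 0 < \<epsilon> \<and> \<epsilon> < l powr (- 1 / real m) \<longrightarrow>
      norm (half_SW (D 0) (s * l) \<epsilon> - exp (\<i> * complex_of_real (s * l * D 0 0)) *
        complex_of_real (ln (l powr (- 1 / real m) / \<epsilon>))) \<le> B)"
    by blast
  then show ?thesis
    by (intro exI[of _ B]) (auto elim!: eventually_mono dest: spec[of _ 1])
next
  case False
  define E where "E j t = - D j t" for j t
  have "derivative_chain E"
    using D by (auto simp: derivative_chain_def E_def [abs_def] intro!: DERIV_minus)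
  from half_SW_finite_order_pos[OF this, of m] m False obtain B where
    "\<forall>\<^sub>F l in at_top. \<forall>s. \<bar>s\<bar> = 1 \<longrightarrow> (\<forall>\<epsilon>. 0 < \<epsilon> \<and> \<epsilon> < l powr (- 1 / real m) \<longrightarrow>
      norm (half_SW (E 0) (s * l) \<epsilon> - exp (\<i> * complex_of_real (s * l * E 0 0)) *
        complex_of_real (ln (l powr (- 1 / real m) / \<epsilon>))) \<le> B)"
    by (auto simp: E_def)
  then show ?thesis
  proof (intro exI[of _ B], elim eventually_mono, intro allI impI)
    fix l \<epsilon> :: real
    assume H: "\<forall>s. \<bar>s\<bar> = 1 \<longrightarrow> (\<forall>\<epsilon>. 0 < \<epsilon> \<and> \<epsilon> < l powr (- 1 / real m) \<longrightarrow>
        norm (half_SW (E 0) (s * l) \<epsilon> - exp (\<i> * complex_of_real (s * l * E 0 0)) *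
          complex_of_real (ln (l powr (- 1 / real m) / \<epsilon>))) \<le> B)"
      and e: "0 < \<epsilon> \<and> \<epsilon> < l powr (- 1 / real m)"
    have eq: "half_SW (E 0) (- 1 * l) \<epsilon> = half_SW (D 0) l \<epsilon>" "- 1 * l * E 0 0 = l * D 0 0"
      by (simp_all add: half_SW_def E_def)
    show "norm (half_SW (D 0) l \<epsilon> - exp (\<i> * complex_of_real (l * D 0 0)) *
          complex_of_real (ln (l powr (- 1 / real m) / \<epsilon>))) \<le> B"
      using H[rule_format, OF _ e, of "- 1"] unfolding eq by simp
  qed
qed

text \<open>
  The phase on the negative half line is governed by the chain \<open>R\<close> of the reflected function. It has
  the same value and the same order of vanishing at 0 as \<open>D\<close>, hence the same divergent part.
\<close>
proposition SW_integral_smallo_ln: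
  assumes smooth: "smooth_on_I \<psi>"
  shows "SW_integral \<psi> \<in> o[at_top](\<lambda>l. complex_of_real (ln l))"
proof (rule landau_o.smallI)
  fix c :: real assume c: "0 < c"
  obtain D where D0: "\<And>t. t \<in> {-1..1} \<Longrightarrow> D 0 t = \<psi> t" and D: "derivative_chain D"
    using smooth unfolding smooth_on_I_def derivative_chain_def by blast
  define R where "R j t = (-1) ^ j * D j (- t)" for j t
  have R: "derivative_chain R"
    using derivative_chain_reflect[OF D] by (simp add: R_def [abs_def])
  have half: "half_SW \<psi> l \<epsilon> = half_SW (D 0) l \<epsilon>"
    "half_SW (\<lambda>t. \<psi> (- t)) l \<epsilon> = half_SW (R 0) l \<epsilon>" if "0 < \<epsilon>" for l \<epsilon>
    unfolding half_SW_def R_def by (rule integral_cong; use that in \<open>simp add: D0\<close>)+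
  have ln_big: "\<forall>\<^sub>F l in at_top. B \<le> c / 2 * ln l" for B
  proof -
    have "filterlim (\<lambda>l::real. c / 2 * ln l) at_top at_top"
      by (rule filterlim_tendsto_pos_mult_at_top[OF tendsto_const _ ln_at_top]) (use c in simp)
    then show ?thesis
      by (simp add: filterlim_at_top)
  qed
  have gt1: "\<forall>\<^sub>F l in at_top. (1::real) < l"
    by (rule eventually_gt_at_top)
  have R00: "R 0 0 = D 0 0"
    by (simp add: R_def)
  show "\<forall>\<^sub>F l in at_top. norm (SW_integral \<psi> l) \<le> c * norm (complex_of_real (ln l))"
  proof (cases "\<exists>m>0. D m 0 \<noteq> 0")
    case True
    define m where "m = (LEAST m. 0 < m \<and> D m 0 \<noteq> 0)"
    have m: "0 < m" "D m 0 \<noteq> 0"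
      using LeastI_ex[of "\<lambda>m. 0 < m \<and> D m 0 \<noteq> 0"] True by (auto simp: m_def)
    have z: "D j 0 = 0" if "0 < j" "j < m" for j
      using not_less_Least[of j "\<lambda>m. 0 < m \<and> D m 0 \<noteq> 0"] that by (auto simp: m_def)
    obtain B1 where B1: "\<forall>\<^sub>F l in at_top. \<forall>\<epsilon>. 0 < \<epsilon> \<and> \<epsilon> < l powr (- 1 / real m) \<longrightarrow>
      norm (half_SW (D 0) l \<epsilon> - exp (\<i> * complex_of_real (l * D 0 0)) *
        complex_of_real (ln (l powr (- 1 / real m) / \<epsilon>))) \<le> B1"
      using half_SW_finite_order[OF D m(1) z m(2)] by blast
    have "\<exists>B. \<forall>\<^sub>F l in at_top. \<forall>\<epsilon>. 0 < \<epsilon> \<and> \<epsilon> < l powr (- 1 / real m) \<longrightarrow>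
      norm (half_SW (R 0) l \<epsilon> - exp (\<i> * complex_of_real (l * R 0 0)) *
        complex_of_real (ln (l powr (- 1 / real m) / \<epsilon>))) \<le> B"
      by (rule half_SW_finite_order[OF R m(1)]) (use z m in \<open>auto simp: R_def\<close>)
    then obtain B2 where B2: "\<forall>\<^sub>F l in at_top. \<forall>\<epsilon>. 0 < \<epsilon> \<and> \<epsilon> < l powr (- 1 / real m) \<longrightarrow>
      norm (half_SW (R 0) l \<epsilon> - exp (\<i> * complex_of_real (l * D 0 0)) *
        complex_of_real (ln (l powr (- 1 / real m) / \<epsilon>))) \<le> B2"
      unfolding R00 by blast
    show ?thesis
      using B1 B2 ln_big[of "B1 + B2"] gt1
    proof eventually_elim
      case (elim l)
      have "norm (SW_integral \<psi> l - 0) \<le> B1 + B2"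
        by (rule norm_SW_integral_diff_le[OF smooth, where a = "l powr (- 1 / real m)" and
              z = "\<lambda>\<epsilon>. exp (\<i> * complex_of_real (l * D 0 0)) *
                complex_of_real (ln (l powr (- 1 / real m) / \<epsilon>))"])
           (use elim m in \<open>auto simp: half intro!: less_imp_le[OF powr_less_one]\<close>)
      moreover have "c / 2 * ln l \<le> c * \<bar>ln l\<bar>"
        using elim c by simp
      ultimately show ?case
        using elim by simp
    qed
  next
    case False
    \<comment> \<open>The two half integrals contribute \<open>4 * ln l / N\<close>, which is to be at most \<open>c / 2 * ln l\<close>.\<close>
    obtain N :: nat where N: "8 / c < N"
      using reals_Archimedean2 by blast
    then have N0: "0 < N"
      using c less_trans[of 0 "8 / c" "real N"] by simp
    have flat: "D j 0 = 0" if "0 < j" for j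
      using False that by blast
    then have "R j 0 = 0" if "0 < j" for j
      using that by (simp add: R_def)
    with flat half_SW_infinite_order[OF D _ N0] half_SW_infinite_order[OF R _ N0]
    obtain C1 C2 where C: "\<And>l \<epsilon>. 1 < l \<Longrightarrow> 0 < \<epsilon> \<and> \<epsilon> < l powr (- 1 / real N) \<Longrightarrow>
      norm (half_SW (D 0) l \<epsilon> - exp (\<i> * complex_of_real (l * D 0 0)) * complex_of_real (ln (1 / \<epsilon>)))
        \<le> C1 + 2 * ln l / real N"
      "\<And>l \<epsilon>. 1 < l \<Longrightarrow> 0 < \<epsilon> \<and> \<epsilon> < l powr (- 1 / real N) \<Longrightarrow>
      norm (half_SW (R 0) l \<epsilon> - exp (\<i> * complex_of_real (l * D 0 0)) * complex_of_real (ln (1 / \<epsilon>)))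
        \<le> C2 + 2 * ln l / real N"
      unfolding R00 by blast
    show ?thesis
      using ln_big[of "C1 + C2"] gt1
    proof eventually_elim
      case (elim l)
      have "norm (SW_integral \<psi> l - 0) \<le> (C1 + 2 * ln l / N) + (C2 + 2 * ln l / N)"
        by (rule norm_SW_integral_diff_le[OF smooth, where a = "l powr (- 1 / real N)" and
              z = "\<lambda>\<epsilon>. exp (\<i> * complex_of_real (l * D 0 0)) * complex_of_real (ln (1 / \<epsilon>))"])
           (use elim C N0 in \<open>auto simp: half intro!: less_imp_le[OF powr_less_one]\<close>)
      moreover have "4 * ln l / N \<le> c / 2 * ln l"
      proof -
        have "4 / N \<le> c / 2"
          using N N0 c by (simp add: field_simps)
        then show ?thesis
          using mult_right_mono[of "4 / N" "c / 2" "ln l"] elim by simp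
      qed
      ultimately show ?case
        using elim c by simp
    qed
  qed
qed

section \<open>Iterated logarithms and their derivatives\<close>

abbreviation (input) iter_ln :: "nat \<Rightarrow> real \<Rightarrow> real" where
  "iter_ln j \<equiv> ln ^^ j"

lemma filterlim_iter_ln: "filterlim (iter_ln j) at_top at_top"
proof (induction j)
  case 0
  then show ?case
    by (simp add: filterlim_ident id_def)
next
  case (Suc j)
  then show ?case
    using filterlim_compose[OF ln_at_top] by (simp add: o_def)
qed

primrec iter_ln_deriv :: "nat \<Rightarrow> real \<Rightarrow> real" where
  "iter_ln_deriv 0 x = 1"
| "iter_ln_deriv (Suc j) x = iter_ln_deriv j x / iter_ln j x"

primrec iter_ln_deriv2 :: "nat \<Rightarrow> real \<Rightarrow> real" where
  "iter_ln_deriv2 0 x = 0"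
| "iter_ln_deriv2 (Suc j) x =
     iter_ln_deriv2 j x / iter_ln j x - iter_ln_deriv j x * iter_ln_deriv j x / (iter_ln j x)\<^sup>2"

text \<open>
  Beyond \<open>x0\<close> the logarithms up to order \<open>J\<close> are at least 2. The constant 2 makes reciprocals harmless
  and squares absorbable: it gives \<open>ln (2 * y) \<le> 2 * ln y\<close> and outweighs the first derivatives.
\<close>
locale iter_ln_large =
  fixes J :: nat and x0 :: real
  assumes iter_ln_ge: "\<And>j x. j \<le> J \<Longrightarrow> x0 \<le> x \<Longrightarrow> 2 \<le> iter_ln j x"
begin

lemma x0_ge: "2 \<le> x0"
  using iter_ln_ge[of 0 x0] by simp

lemma DERIV_iter_ln:
  assumes "j \<le> J" "x0 \<le> x"
  shows "(iter_ln j has_real_derivative iter_ln_deriv j x) (at x)"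
  using assms(1)
proof (induction j)
  case (Suc j)
  then have "2 \<le> iter_ln j x"
    using iter_ln_ge assms(2) by simp
  with Suc show ?case
    by (auto simp: o_def intro!: derivative_eq_intros)
qed (simp add: id_def)

lemma DERIV_iter_ln_deriv:
  assumes "j \<le> J" "x0 \<le> x"
  shows "(iter_ln_deriv j has_real_derivative iter_ln_deriv2 j x) (at x)"
  using assms(1)
proof (induction j)
  case (Suc j)
  have "2 \<le> iter_ln j x" "(iter_ln j has_real_derivative iter_ln_deriv j x) (at x)"
    using Suc.prems iter_ln_ge[of j x] DERIV_iter_ln[of j x] assms(2) by auto
  with Suc show ?case
    by (auto intro!: derivative_eq_intros simp: power2_eq_square field_simps)
next
  case 0
  have "iter_ln_deriv 0 = (\<lambda>x. 1)"
    by (simp add: fun_eq_iff)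
  then show ?case by simp
qed

text \<open>
  Iterated logarithms are increasing, contracting and concave; concavity is what keeps \<open>t \<psi>'(t)\<close>
  increasing for the phase constructed below.
\<close>
lemma iter_ln_deriv_bounds:
  assumes "j \<le> J" "x0 \<le> x"
  shows "0 \<le> iter_ln_deriv j x" "iter_ln_deriv j x \<le> 1" "iter_ln_deriv2 j x \<le> 0"
proof -
  have "0 \<le> iter_ln_deriv j x \<and> iter_ln_deriv j x \<le> 1 \<and> iter_ln_deriv2 j x \<le> 0"
    using assms(1)
  proof (induction j)
    case (Suc j)
    then have IH: "0 \<le> iter_ln_deriv j x" "iter_ln_deriv j x \<le> 1" "iter_ln_deriv2 j x \<le> 0"
      by auto
    have l: "2 \<le> iter_ln j x"
      using Suc.prems iter_ln_ge[of j x] assms(2) by auto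
    have "0 \<le> iter_ln_deriv j x / iter_ln j x"
      by (rule divide_nonneg_nonneg) (use IH l in linarith)+
    moreover have "iter_ln_deriv j x / iter_ln j x \<le> 1"
      by (subst pos_divide_le_eq) (use IH l in linarith)+
    moreover have "iter_ln_deriv2 j x / iter_ln j x \<le> 0"
      by (rule divide_nonpos_pos) (use IH l in linarith)+
    moreover have "0 \<le> iter_ln_deriv j x * iter_ln_deriv j x / (iter_ln j x)\<^sup>2"
      by simp
    ultimately show ?case
      unfolding iter_ln_deriv.simps iter_ln_deriv2.simps by linarith
  qed auto
  then show "0 \<le> iter_ln_deriv j x" "iter_ln_deriv j x \<le> 1" "iter_ln_deriv2 j x \<le> 0"
    by auto
qed

lemma iter_ln_mono:
  assumes "j \<le> J" "x0 \<le> x" "x \<le> y"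
  shows "iter_ln j x \<le> iter_ln j y"
  using assms(1)
proof (induction j)
  case (Suc j)
  then show ?case
    using iter_ln_ge[of j x] iter_ln_ge[of j y] assms by simp
qed (use assms in simp)

text \<open>
  The first logarithm turns the square into a factor 2, and each further logarithm turns the factor 2
  into a summand \<open>ln 2\<close>, which is absorbed by doubling.
\<close>
lemma iter_ln_square_le:
  assumes "0 < j" "j \<le> J" "x0 \<le> x"
  shows "iter_ln j (x\<^sup>2) \<le> 2 * iter_ln j x"
  using assms(1,2)
proof (induction j rule: nat_induct_non_zero)
  case 1
  then show ?case
    using x0_ge assms(3) by (simp add: ln_realpow)
next
  case (Suc j)
  let ?y = "iter_ln j x"
  have y: "2 \<le> ?y" "2 \<le> ln ?y"
    using iter_ln_ge[of j x] iter_ln_ge[of "Suc j" x] Suc.prems assms(3) by auto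
  have "x0 \<le> x\<^sup>2"
    using x0_ge assms(3) self_le_power[of x 2] by simp
  then have "0 < iter_ln j (x\<^sup>2)"
    using iter_ln_ge[of j "x\<^sup>2"] Suc.prems by simp
  then have "ln (iter_ln j (x\<^sup>2)) \<le> ln (2 * ?y)"
    using Suc y by simp
  also have "\<dots> = ln 2 + ln ?y"
    using y by (simp add: ln_mult)
  also have "ln 2 \<le> ln ?y"
    using y by simp
  finally show ?case by simp
qed

lemma iter_ln_le_self:
  assumes "j \<le> J" "x0 \<le> x"
  shows "iter_ln j x \<le> x"
  using assms(1)
proof (induction j)
  case (Suc j)
  then show ?case
    using iter_ln_ge[of j x] ln_le_minus_one[of "iter_ln j x"] assms by simp
qed simp

text \<open>
  The argument lies between \<open>x\<close> and \<open>x\<^sup>2\<close>. This is where at least one logarithm is needed in \<open>L\<close>, that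
  is \<open>k \<ge> 2\<close>.
\<close>
lemma iter_ln_mult_self_bounds:
  assumes "0 < J" "x0 \<le> x"
  shows "iter_ln J x \<le> iter_ln J (x * iter_ln J x)" "iter_ln J (x * iter_ln J x) \<le> 2 * iter_ln J x"
proof -
  have L: "2 \<le> iter_ln J x" "iter_ln J x \<le> x"
    using iter_ln_ge iter_ln_le_self assms by auto
  have x: "x * 1 \<le> x * iter_ln J x" "x * iter_ln J x \<le> x * x"
    using L x0_ge assms by (intro mult_left_mono; simp)+
  show "iter_ln J x \<le> iter_ln J (x * iter_ln J x)"
    by (rule iter_ln_mono) (use x assms in auto)
  have "iter_ln J (x * iter_ln J x) \<le> iter_ln J (x\<^sup>2)"
    by (rule iter_ln_mono) (use x assms in \<open>auto simp: power2_eq_square\<close>)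
  then show "iter_ln J (x * iter_ln J x) \<le> 2 * iter_ln J x"
    using iter_ln_square_le[of J x] assms by simp
qed

section \<open>A smooth phase that decays barely faster than all powers\<close>

text \<open>
  The shift by \<open>x0\<close> puts the whole interval \<open>(0, 1]\<close> into the range where the iterated logarithms are
  well behaved, so that the phase is given by a single formula up to 1.
\<close>
definition depth :: "real \<Rightarrow> real" where
  "depth t = x0 - ln t"

lemma depth_ge: "0 < t \<Longrightarrow> t \<le> 1 \<Longrightarrow> x0 \<le> depth t"
  by (simp add: depth_def)

text \<open>
  All derivatives of the phase have the form weight times symbol. The generators are chosen so that
  the class is closed under differentiation, while every member still has at most polynomial growth in
  \<open>1 / t\<close>; an induction over this class replaces explicit formulas for higher derivatives.
\<close>
inductive symbol :: "(real \<Rightarrow> real) \<Rightarrow> bool" where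
  symbol_const: "symbol (\<lambda>t. c)"
| symbol_inverse: "symbol (\<lambda>t. 1 / t)"
| symbol_iter_ln: "j \<le> J \<Longrightarrow> symbol (\<lambda>t. iter_ln j (depth t))"
| symbol_inverse_iter_ln: "j \<le> J \<Longrightarrow> symbol (\<lambda>t. 1 / iter_ln j (depth t))"
| symbol_add: "symbol f \<Longrightarrow> symbol g \<Longrightarrow> symbol (\<lambda>t. f t + g t)"
| symbol_mult: "symbol f \<Longrightarrow> symbol g \<Longrightarrow> symbol (\<lambda>t. f t * g t)"

lemma symbol_iter_ln_deriv:
  assumes "j \<le> J"
  shows "symbol (\<lambda>t. iter_ln_deriv j (depth t))"
  using assms
proof (induction j)
  case 0
  then show ?case
    by (simp add: symbol_const)
next
  case (Suc j)
  then show ?case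
    using symbol_mult[OF Suc.IH symbol_inverse_iter_ln[of j]] by simp
qed

lemma DERIV_iter_ln_depth:
  assumes "j \<le> J" "0 < t" "t \<le> 1"
  shows "((\<lambda>t. iter_ln j (depth t)) has_real_derivative
           - 1 * (iter_ln_deriv j (depth t) * (1 / t))) (at t)"
proof -
  have "(depth has_real_derivative - (1 / t)) (at t)"
    unfolding depth_def [abs_def] using assms by (auto intro!: derivative_eq_intros)
  from DERIV_chain[OF DERIV_iter_ln[OF assms(1) depth_ge[OF assms(2,3)]] this]
  show ?thesis
    by (simp add: o_def)
qed

lemma symbol_has_derivative:
  assumes "symbol f"
  shows "\<exists>f'. symbol f' \<and> (\<forall>t. 0 < t \<longrightarrow> t \<le> 1 \<longrightarrow> (f has_real_derivative f' t) (at t))"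
  using assms
proof induction
  case (symbol_const c)
  then show ?case
    by (intro exI[of _ "\<lambda>t. 0"]) (auto intro: symbol.symbol_const)
next
  case symbol_inverse
  show ?case
    by (intro exI[of _ "\<lambda>t. - 1 * (1 / t * (1 / t))"] conjI symbol.intros)
       (auto intro!: derivative_eq_intros simp: power2_eq_square)
next
  case (symbol_iter_ln j)
  then show ?case
    by (intro exI[of _ "\<lambda>t. - 1 * (iter_ln_deriv j (depth t) * (1 / t))"] conjI allI impI
        symbol.intros symbol_iter_ln_deriv DERIV_iter_ln_depth)
next
  case (symbol_inverse_iter_ln j)
  let ?h = "\<lambda>t. 1 / iter_ln j (depth t)"
  show ?case
  proof (intro exI[of _ "\<lambda>t. iter_ln_deriv j (depth t) * (1 / t) * (?h t * ?h t)"] conjI allI impI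
      symbol_mult symbol_inverse symbol.symbol_inverse_iter_ln symbol_iter_ln_deriv
      symbol_inverse_iter_ln)
    fix t :: real assume t: "0 < t" "t \<le> 1"
    have "2 \<le> iter_ln j (depth t)"
      by (rule iter_ln_ge[OF symbol_inverse_iter_ln depth_ge[OF t]])
    with DERIV_iter_ln_depth[OF symbol_inverse_iter_ln t] t
    show "(?h has_real_derivative iter_ln_deriv j (depth t) * (1 / t) * (?h t * ?h t)) (at t)"
      by (auto intro!: derivative_eq_intros)
  qed
next
  case (symbol_add f g)
  then obtain f' g' where "symbol f'" "symbol g'"
    "\<forall>t. 0 < t \<longrightarrow> t \<le> 1 \<longrightarrow> (f has_real_derivative f' t) (at t)"
    "\<forall>t. 0 < t \<longrightarrow> t \<le> 1 \<longrightarrow> (g has_real_derivative g' t) (at t)"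
    by blast
  then show ?case
    by (intro exI[of _ "\<lambda>t. f' t + g' t"]) (auto intro: symbol.symbol_add DERIV_add)
next
  case (symbol_mult f g)
  then obtain f' g' where "symbol f'" "symbol g'"
    "\<forall>t. 0 < t \<longrightarrow> t \<le> 1 \<longrightarrow> (f has_real_derivative f' t) (at t)"
    "\<forall>t. 0 < t \<longrightarrow> t \<le> 1 \<longrightarrow> (g has_real_derivative g' t) (at t)"
    by blast
  then show ?case
    using symbol_mult.hyps
    by (intro exI[of _ "\<lambda>t. f' t * g t + g' t * f t"])
       (auto intro!: symbol.symbol_add symbol.symbol_mult DERIV_mult)
qed

lemma symbol_bound:
  assumes "symbol f"
  shows "\<exists>C M. 0 \<le> C \<and> (\<forall>t. 0 < t \<longrightarrow> t \<le> 1 \<longrightarrow> \<bar>f t\<bar> \<le> C * (1 / t) ^ M)"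
  using assms
proof induction
  case (symbol_const c)
  then show ?case
    by (intro exI[of _ "\<bar>c\<bar>"] exI[of _ 0]) simp
next
  case symbol_inverse
  show ?case
    by (intro exI[of _ 1]) simp
next
  case (symbol_iter_ln j)
  have "\<bar>iter_ln j (depth t)\<bar> \<le> x0 * (1 / t) ^ 1" if t: "0 < t" "t \<le> 1" for t
  proof -
    have "0 \<le> iter_ln j (depth t)"
      using iter_ln_ge[OF symbol_iter_ln depth_ge[OF t]] by simp
    moreover have "iter_ln j (depth t) \<le> x0 + ln (1 / t)"
      using iter_ln_le_self[OF symbol_iter_ln depth_ge[OF t]] t by (simp add: depth_def ln_div)
    moreover have "ln (1 / t) \<le> 1 / t - 1"
      using t by (intro ln_le_minus_one) simp
    moreover have "(x0 - 1) * 1 \<le> (x0 - 1) * (1 / t)"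
      using x0_ge t by (intro mult_left_mono) auto
    ultimately show ?thesis
      by (simp add: diff_divide_distrib)
  qed
  then show ?case
    using x0_ge by (intro exI[of _ x0] exI[of _ 1]) auto
next
  case (symbol_inverse_iter_ln j)
  have "\<bar>1 / iter_ln j (depth t)\<bar> \<le> 1" if t: "0 < t" "t \<le> 1" for t
    using iter_ln_ge[OF symbol_inverse_iter_ln depth_ge[OF t]] by simp
  then show ?case
    by (intro exI[of _ 1] exI[of _ 0]) auto
next
  case (symbol_add f g)
  then obtain C M C' M' where C: "0 \<le> C" "0 \<le> C'"
    "\<And>t. 0 < t \<Longrightarrow> t \<le> 1 \<Longrightarrow> \<bar>f t\<bar> \<le> C * (1 / t) ^ M"
    "\<And>t. 0 < t \<Longrightarrow> t \<le> 1 \<Longrightarrow> \<bar>g t\<bar> \<le> C' * (1 / t) ^ M'"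
    by blast
  have "\<bar>f t + g t\<bar> \<le> (C + C') * (1 / t) ^ (M + M')" if t: "0 < t" "t \<le> 1" for t
  proof -
    have "(1 / t) ^ M \<le> (1 / t) ^ (M + M')" "(1 / t) ^ M' \<le> (1 / t) ^ (M + M')"
      using t by (intro power_increasing; simp)+
    then have "C * (1 / t) ^ M \<le> C * (1 / t) ^ (M + M')" "C' * (1 / t) ^ M' \<le> C' * (1 / t) ^ (M + M')"
      using C by (intro mult_left_mono; simp)+
    then show ?thesis
      using C(3)[OF t] C(4)[OF t] by (simp add: distrib_right)
  qed
  then show ?case
    using C(1,2) by (intro exI[of _ "C + C'"] exI[of _ "M + M'"]) simp
next
  case (symbol_mult f g)
  then obtain C M C' M' where C: "0 \<le> C" "0 \<le> C'"
    "\<And>t. 0 < t \<Longrightarrow> t \<le> 1 \<Longrightarrow> \<bar>f t\<bar> \<le> C * (1 / t) ^ M"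
    "\<And>t. 0 < t \<Longrightarrow> t \<le> 1 \<Longrightarrow> \<bar>g t\<bar> \<le> C' * (1 / t) ^ M'"
    by blast
  have "\<bar>f t * g t\<bar> \<le> (C * C') * (1 / t) ^ (M + M')" if t: "0 < t" "t \<le> 1" for t
    using mult_mono[OF C(3)[OF t] C(4)[OF t]] C(1) t by (simp add: abs_mult power_add mult_ac)
  then show ?case
    using C(1,2) by (intro exI[of _ "C * C'"] exI[of _ "M + M'"]) simp
qed

definition weight :: "real \<Rightarrow> real" where
  "weight t = exp (- (depth t * iter_ln J (depth t)))"

text \<open>
  Extending by 0 to the left is smooth because the weight beats every symbol at 0. The family of these
  extensions is closed under differentiation, including the point 0.
\<close>
definition flat_ext :: "(real \<Rightarrow> real) \<Rightarrow> real \<Rightarrow> real" where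
  "flat_ext f t = (if t \<le> 0 then 0 else weight t * f t)"

text \<open>
  Since \<open>depth t \<ge> - ln t\<close>, the weight is at most \<open>t\<close> to the power \<open>iter_ln J (depth t)\<close>, an
  exponent that tends to infinity and eventually exceeds the degree of the symbol by 1.
\<close>
lemma weight_symbol_tendsto_0:
  assumes "symbol f"
  shows "((\<lambda>t. weight t * f t) \<longlongrightarrow> 0) (at_right 0)"
proof -
  obtain C M where C: "0 \<le> C" "\<And>t. 0 < t \<Longrightarrow> t \<le> 1 \<Longrightarrow> \<bar>f t\<bar> \<le> C * (1 / t) ^ M"
    using symbol_bound[OF assms] by blast
  have "filterlim (\<lambda>t::real. ln (inverse t)) at_top (at_right 0)"
    by (rule filterlim_compose[OF ln_at_top filterlim_inverse_at_top_right])
  then have "filterlim (\<lambda>t. x0 + ln (inverse t)) at_top (at_right 0)"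
    by (rule filterlim_tendsto_add_at_top[OF tendsto_const])
  then have "filterlim depth at_top (at_right 0)"
    by (simp add: depth_def [abs_def] ln_inverse)
  from filterlim_compose[OF filterlim_iter_ln this]
  have "\<forall>\<^sub>F t in at_right 0. real (M + 1) \<le> iter_ln J (depth t)"
    by (auto simp: filterlim_at_top)
  moreover have "\<forall>\<^sub>F t in at_right 0. (0::real) < t \<and> t < 1"
    unfolding eventually_at_right_field by (rule exI[of _ 1]) auto
  ultimately have "\<forall>\<^sub>F t in at_right 0. norm (weight t * f t) \<le> C * t"
  proof eventually_elim
    case (elim t)
    then have t: "0 < t" "t \<le> 1"
      by auto
    have "- ln t * real (M + 1) \<le> depth t * iter_ln J (depth t)"
    proof (rule mult_mono)
      show "- ln t \<le> depth t"
        using x0_ge by (simp add: depth_def)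
      show "0 \<le> depth t"
        using depth_ge[OF t] x0_ge by simp
    qed (use elim in auto)
    then have "weight t \<le> exp (real (M + 1) * ln t)"
      by (simp add: weight_def algebra_simps)
    also have "\<dots> = t ^ (M + 1)"
      using t by (simp only: exp_of_nat_mult exp_ln)
    finally have w: "weight t \<le> t ^ (M + 1)" .
    have "norm (weight t * f t) = weight t * \<bar>f t\<bar>"
      by (simp add: abs_mult weight_def)
    also have "\<dots> \<le> t ^ (M + 1) * (C * (1 / t) ^ M)"
      by (rule mult_mono[OF w C(2)[OF t]]) (use t in auto)
    also have "\<dots> = C * t"
      using t by (simp add: power_divide)
    finally show ?case .
  qed
  moreover have "((\<lambda>t. C * t) \<longlongrightarrow> 0) (at_right (0::real))"
    by (intro tendsto_mult_right_zero tendsto_ident_at)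
  ultimately show ?thesis
    by (rule Lim_null_comparison)
qed

lemma DERIV_weight:
  assumes "0 < t" "t \<le> 1"
  shows "(weight has_real_derivative
     weight t * ((iter_ln J (depth t) + depth t * iter_ln_deriv J (depth t)) * (1 / t))) (at t)"
proof -
  have "(depth has_real_derivative - (1 / t)) (at t)"
    using DERIV_iter_ln_depth[of 0 t] assms by simp
  note [derivative_intros] = this DERIV_iter_ln_depth[OF order.refl assms]
  show ?thesis
    unfolding weight_def [abs_def] by (rule derivative_eq_intros refl)+ (simp add: algebra_simps)
qed

text \<open>
  On \<open>(0, 1]\<close> the logarithmic derivative \<open>p\<close> of the weight is a symbol, so the product rule stays within
  the family. At 0 the difference quotient is weight times the symbol \<open>f t / t\<close>, which tends to 0.
\<close>
lemma flat_ext_has_derivative: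
  assumes "symbol f"
  shows "\<exists>f'. symbol f' \<and>
    (\<forall>t\<in>{-1..1}. (flat_ext f has_real_derivative flat_ext f' t) (at t within {-1..1}))"
proof -
  obtain f' where f': "symbol f'"
    "\<And>t. 0 < t \<Longrightarrow> t \<le> 1 \<Longrightarrow> (f has_real_derivative f' t) (at t)"
    using symbol_has_derivative[OF assms] by blast
  define p where "p t = (iter_ln J (depth t) + depth t * iter_ln_deriv J (depth t)) * (1 / t)" for t
  define g where "g t = p t * f t + f' t" for t
  have "symbol (\<lambda>t. depth t)"
    using symbol_iter_ln[of 0] by simp
  then have "symbol g"
    unfolding g_def [abs_def] p_def
    by (intro symbol_add symbol_mult symbol_iter_ln symbol_iter_ln_deriv symbol_inverse f' assms)
       auto
  moreover have "(flat_ext f has_real_derivative flat_ext g t) (at t)" if "t \<le> 1" for t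
  proof (cases t "0::real" rule: linorder_cases)
    case less
    have "\<forall>\<^sub>F s in nhds t. s < 0"
      using less by (intro eventually_nhds_in_open[of "{..<0}", simplified]) auto
    then have "\<forall>\<^sub>F s in nhds t. flat_ext f s = 0"
      by eventually_elim (simp add: flat_ext_def)
    then show ?thesis
      using less by (subst DERIV_cong_ev[OF refl _ refl]) (auto simp: flat_ext_def)
  next
    case greater
    have "\<forall>\<^sub>F s in nhds t. 0 < s"
      using greater by (intro eventually_nhds_in_open[of "{0<..}", simplified]) auto
    then have "\<forall>\<^sub>F s in nhds t. flat_ext f s = weight s * f s"
      by eventually_elim (simp add: flat_ext_def)
    moreover have "((\<lambda>s. weight s * f s) has_real_derivative flat_ext g t) (at t)"
      using DERIV_mult[OF DERIV_weight[OF greater that] f'(2)[OF greater that]] greater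
      by (simp add: flat_ext_def g_def p_def algebra_simps)
    ultimately show ?thesis
      by (subst DERIV_cong_ev[OF refl _ refl])
  next
    case equal
    have "((\<lambda>s. weight s * (f s * (1 / s))) \<longlongrightarrow> 0) (at_right 0)"
      by (intro weight_symbol_tendsto_0 symbol_mult symbol_inverse assms)
    then have "((\<lambda>s. flat_ext f s / s) \<longlongrightarrow> 0) (at_right 0)"
      by (rule Lim_transform_eventually)
         (auto simp: flat_ext_def eventually_at_right_field intro!: exI[of _ 1])
    moreover have "((\<lambda>s. flat_ext f s / s) \<longlongrightarrow> 0) (at_left 0)"
      by (rule Lim_transform_eventually[OF tendsto_const])
         (auto simp: flat_ext_def eventually_at_left_field intro!: exI[of _ "-1"])
    ultimately have "((\<lambda>s. flat_ext f s / s) \<longlongrightarrow> 0) (at 0)"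
      by (simp add: filterlim_split_at)
    then show ?thesis
      by (simp add: equal has_field_derivative_iff flat_ext_def)
  qed
  ultimately show ?thesis
    by (intro exI[of _ g]) (auto intro: has_field_derivative_at_within)
qed

definition flat_phase :: "real \<Rightarrow> real" where
  "flat_phase = flat_ext (\<lambda>t. 1)"

lemma smooth_flat_phase: "smooth_on_I flat_phase"
proof -
  have "\<exists>F. \<forall>n. (symbol (F n) \<and> (n = 0 \<longrightarrow> F n = (\<lambda>t. 1))) \<and>
      (\<forall>t\<in>{-1..1}. (flat_ext (F n) has_real_derivative flat_ext (F (Suc n)) t) (at t within {-1..1}))"
  proof (rule dependent_nat_choice)
    show "\<exists>f. symbol f \<and> ((0::nat) = 0 \<longrightarrow> f = (\<lambda>t. 1))"
      using symbol_const by blast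
    fix f and n :: nat
    assume "symbol f \<and> (n = 0 \<longrightarrow> f = (\<lambda>t. 1))"
    then obtain g where "symbol g"
      "\<forall>t\<in>{-1..1}. (flat_ext f has_real_derivative flat_ext g t) (at t within {-1..1})"
      using flat_ext_has_derivative by blast
    then show "\<exists>g. (symbol g \<and> (Suc n = 0 \<longrightarrow> g = (\<lambda>t. 1))) \<and>
        (\<forall>t\<in>{-1..1}. (flat_ext f has_real_derivative flat_ext g t) (at t within {-1..1}))"
      by (intro exI[of _ g] conjI) simp_all
  qed
  then obtain F where F: "F 0 = (\<lambda>t. 1)"
    "\<forall>n. \<forall>t\<in>{-1..1}. (flat_ext (F n) has_real_derivative flat_ext (F (Suc n)) t) (at t within {-1..1})"
    by blast
  then show ?thesis
    unfolding smooth_on_I_def flat_phase_def by (intro exI[of _ "\<lambda>n. flat_ext (F n)"] conjI F ballI) (simp add: F)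
qed

lemma flat_phase_pos: "0 < t \<Longrightarrow> flat_phase t = weight t"
  and flat_phase_nonpos: "t \<le> 0 \<Longrightarrow> flat_phase t = 0"
  by (auto simp: flat_phase_def flat_ext_def)

text \<open>
  With \<open>q\<close> the logarithmic derivative of the weight in the variable \<open>ln t\<close>, one has
  \<open>t \<psi>'(t) = weight t * q t\<close>, and the derivative of this has the sign of \<open>q\<^sup>2 + t q'\<close>, which is
  non-negative by concavity of the iterated logarithm and \<open>q \<ge> 2\<close>. So the description of the half
  integrals applies on all of \<open>(0, 1]\<close> with \<open>K = b = 1\<close>, while the left half integral has constant phase
  and is exactly \<open>ln (1 / \<epsilon>)\<close>.
\<close>
lemma norm_SW_flat_phase_sub_ln_le:
  assumes a: "0 < a" "a \<le> 1"
  shows "norm (SW_integral flat_phase (1 / weight a) - complex_of_real (ln a)) \<le> 3"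
proof -
  define l where "l = 1 / weight a"
  have l: "0 < l" "l * weight a = 1"
    by (auto simp: l_def weight_def)
  define q where "q t = iter_ln J (depth t) + depth t * iter_ln_deriv J (depth t)" for t
  define q' where "q' t = - ((2 * iter_ln_deriv J (depth t) + depth t * iter_ln_deriv2 J (depth t)) / t)" for t
  have cont: "continuous_on {0..1} flat_phase"
    by (rule continuous_on_subset[OF smooth_on_I_continuous[OF smooth_flat_phase]]) auto
  have dq: "(q has_real_derivative q' t) (at t)" if t: "0 < t" "t \<le> 1" for t
  proof -
    have dd: "(depth has_real_derivative - (1 / t)) (at t)"
      using DERIV_iter_ln_depth[of 0 t] t by simp
    have "((\<lambda>t. iter_ln_deriv J (depth t)) has_real_derivative
        iter_ln_deriv2 J (depth t) * - (1 / t)) (at t)"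
      using DERIV_chain[OF DERIV_iter_ln_deriv[OF order.refl depth_ge[OF t]] dd] by (simp add: o_def)
    note [derivative_intros] = this dd DERIV_iter_ln_depth[OF order.refl t]
    show ?thesis
      unfolding q_def [abs_def] q'_def
      by (rule derivative_eq_intros refl)+ (use t in \<open>simp add: field_simps\<close>)
  qed
  have q: "2 \<le> q t" "0 \<le> (q t)\<^sup>2 + t * q' t" if t: "0 < t" "t \<le> 1" for t
  proof -
    note d = iter_ln_deriv_bounds[OF order.refl depth_ge[OF t]]
    have x: "0 < depth t"
      using depth_ge[OF t] x0_ge by simp
    show q2: "2 \<le> q t"
      using iter_ln_ge[OF order.refl depth_ge[OF t]] d(1) x by (simp add: q_def add_increasing2)
    have "2\<^sup>2 \<le> (q t)\<^sup>2"
      using q2 by (intro power_mono) auto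
    moreover have "t * q' t = - 2 * iter_ln_deriv J (depth t) - depth t * iter_ln_deriv2 J (depth t)"
      using t by (simp add: q'_def)
    moreover have "depth t * iter_ln_deriv2 J (depth t) \<le> 0"
      using d(3) x by (simp add: mult_nonneg_nonpos)
    ultimately show "0 \<le> (q t)\<^sup>2 + t * q' t"
      using d(2) by simp
  qed
  have w: "(weight has_real_derivative weight t * (q t / t)) (at t)" if "0 < t" "t \<le> 1" for t
    using DERIV_weight[OF that] by (simp add: q_def)
  have right: "norm (half_SW flat_phase l \<epsilon> - complex_of_real (ln (a / \<epsilon>))) \<le> 3"
    if e: "0 < \<epsilon>" "\<epsilon> < a" for \<epsilon>
  proof -
    have "norm (half_SW flat_phase l \<epsilon> - exp (\<i> * complex_of_real (l * flat_phase 0)) *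
        complex_of_real (ln (a / \<epsilon>))) \<le> 1 * 1 + 2 * 1 / 1 + ln (1 / 1)"
    proof (rule norm_half_SW_sub_ln_le[OF cont])
      fix t :: real assume t: "0 < t" "t \<le> 1"
      have "\<forall>\<^sub>F s in nhds t. 0 < s"
        using t by (intro eventually_nhds_in_open[of "{0<..}", simplified]) auto
      then have "\<forall>\<^sub>F s in nhds t. flat_phase s = weight s"
        by eventually_elim (simp add: flat_phase_pos)
      then show "(flat_phase has_real_derivative weight t * (q t / t)) (at t)"
        using w[OF t] by (subst DERIV_cong_ev[OF refl _ refl])
      show "((\<lambda>t. weight t * (q t / t)) has_real_derivative
          weight t * ((q t)\<^sup>2 - q t + t * q' t) / t\<^sup>2) (at t)"
        by (rule DERIV_cong[OF DERIV_mult[OF w[OF t] DERIV_divide[OF dq[OF t] DERIV_ident]]])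
           (use less_imp_neq[OF t(1), symmetric] in \<open>simp_all add: field_simps power2_eq_square\<close>)
      have wt: "0 < weight t"
        by (simp add: weight_def)
      show "0 < weight t * (q t / t)"
        using wt q(1)[OF t] t by simp
      have "weight t * (q t / t) + t * (weight t * ((q t)\<^sup>2 - q t + t * q' t) / t\<^sup>2)
          = weight t * ((q t)\<^sup>2 + t * q' t) / t"
        using t by (simp add: field_simps power2_eq_square)
      then show "0 \<le> weight t * (q t / t) + t * (weight t * ((q t)\<^sup>2 - q t + t * q' t) / t\<^sup>2)"
        using q(2)[OF t] wt t by simp
      have "weight t * 1 \<le> weight t * q t"
        using q(1)[OF t] wt by (intro mult_left_mono) auto
      then show "flat_phase 0 \<le> flat_phase t \<and> flat_phase t - flat_phase 0 \<le> 1 * (t * (weight t * (q t / t)))"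
        using t wt by (simp add: flat_phase_pos flat_phase_nonpos)
    qed (use a e l in \<open>auto simp: flat_phase_pos flat_phase_nonpos\<close>)
    then show ?thesis
      by (simp add: flat_phase_nonpos)
  qed
  have left: "norm (half_SW (\<lambda>t. flat_phase (- t)) l \<epsilon> -
      (complex_of_real (ln (a / \<epsilon>)) - complex_of_real (ln a))) \<le> 0"
    if e: "0 < \<epsilon>" "\<epsilon> < a" for \<epsilon>
  proof -
    have "half_SW (\<lambda>t. flat_phase (- t)) l \<epsilon> = integral {\<epsilon>..1} (\<lambda>t. complex_of_real (1 / t))"
      unfolding half_SW_def by (rule integral_cong) (use e in \<open>simp add: flat_phase_nonpos\<close>)
    also have "\<dots> = complex_of_real (ln (1 / \<epsilon>))"
      using has_integral_linear[OF inverse_has_integral_ln[of \<epsilon> 1]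
          bounded_linear_of_real[where 'a = complex]] e a
      by (simp add: o_def has_integral_iff)
    also have "\<dots> = complex_of_real (ln (a / \<epsilon>)) - complex_of_real (ln a)"
      using e a by (simp add: ln_div)
    finally show ?thesis by simp
  qed
  have "norm (SW_integral flat_phase l - complex_of_real (ln a)) \<le> 3 + 0"
    by (rule norm_SW_integral_diff_le[OF smooth_flat_phase a right left])
  then show ?thesis
    by (simp add: l_def)
qed

end

section \<open>Sharpness and the theorem\<close>

text \<open>
  Choosing the transition points \<open>a n\<close> first, and the frequency as \<open>1 / weight (a n)\<close>, makes both
  \<open>ln (ls n)\<close> and the size of the integral explicit: the latter is \<open>n\<close> up to 3, and the quotient of
  logarithms is between half of \<open>x0 + n\<close> and \<open>x0 + n\<close>.
\<close>
proposition SW_integral_sharp: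
  assumes k: "2 \<le> k"
  shows "\<exists>(\<psi> :: real \<Rightarrow> real) (ls :: nat \<Rightarrow> real).
    smooth_on_I \<psi> \<and> (\<forall>n. 0 < ls n) \<and> filterlim ls at_top sequentially \<and>
    (\<exists>c C. 0 < c \<and> 0 < C \<and>
      (\<forall>\<^sub>F n in sequentially.
         c * (ln (ls n) / (ln ^^ k) (ls n)) \<le> cmod (SW_integral \<psi> (ls n)) \<and>
         cmod (SW_integral \<psi> (ls n)) \<le> C * (ln (ls n) / (ln ^^ k) (ls n))))"
proof -
  define J where "J = k - 1"
  have J: "0 < J" "k = Suc J"
    using k by (auto simp: J_def)
  have "\<forall>\<^sub>F x in at_top. \<forall>j\<in>{..J}. 2 \<le> iter_ln j x"
    using filterlim_iter_ln by (intro eventually_ball_finite) (auto simp: filterlim_at_top)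
  then obtain x0 where "\<And>x j. x0 \<le> x \<Longrightarrow> j \<le> J \<Longrightarrow> 2 \<le> iter_ln j x"
    by (auto simp: eventually_at_top_linorder)
  then interpret iter_ln_large J x0
    by unfold_locales auto
  define a where "a n = exp (- real n)" for n
  define x where "x n = x0 + real n" for n
  define ls where "ls n = 1 / weight (a n)" for n
  have x: "x0 \<le> x n" for n
    by (simp add: x_def)
  have a: "0 < a n" "a n \<le> 1" "ln (a n) = - real n" "depth (a n) = x n" for n
    by (auto simp: a_def depth_def x_def)
  have ls: "ls n = exp (x n * iter_ln J (x n))" for n
    by (simp add: ls_def weight_def a exp_minus field_simps)
  have ratio: "x n / 2 \<le> ln (ls n) / (ln ^^ k) (ls n)" "ln (ls n) / (ln ^^ k) (ls n) \<le> x n" for n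
  proof -
    let ?L = "iter_ln J (x n)" and ?K = "iter_ln J (x n * iter_ln J (x n))"
    have K: "(ln ^^ k) (ls n) = ?K" "ln (ls n) = x n * ?L"
      by (simp_all add: J(2) funpow_Suc_right ls del: funpow.simps)
    have L: "2 \<le> ?L" "?L \<le> ?K" "?K \<le> 2 * ?L" "2 \<le> x n"
      using iter_ln_ge[OF order.refl x] iter_ln_mult_self_bounds[OF J(1) x] x x0_ge
      by (auto intro: order_trans)
    have "x n * ?K \<le> x n * (2 * ?L)" "x n * ?L \<le> x n * ?K"
      using L by (intro mult_left_mono; simp)+
    then show "x n / 2 \<le> ln (ls n) / (ln ^^ k) (ls n)" "ln (ls n) / (ln ^^ k) (ls n) \<le> x n"
      unfolding K using L by (simp_all add: field_simps)
  qed
  have SW: "real n - 3 \<le> cmod (SW_integral flat_phase (ls n))"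
    "cmod (SW_integral flat_phase (ls n)) \<le> real n + 3" for n
  proof -
    have "norm (complex_of_real (ln (a n))) = real n"
      by (simp only: norm_of_real a abs_minus_cancel abs_of_nat)
    then have "\<bar>cmod (SW_integral flat_phase (ls n)) - real n\<bar> \<le> 3"
      using norm_SW_flat_phase_sub_ln_le[OF a(1,2)[of n]]
        norm_triangle_ineq3[of "SW_integral flat_phase (ls n)" "complex_of_real (ln (a n))"]
      unfolding ls_def[symmetric] by linarith
    then show "real n - 3 \<le> cmod (SW_integral flat_phase (ls n))"
      "cmod (SW_integral flat_phase (ls n)) \<le> real n + 3"
      unfolding abs_le_iff by simp_all
  qed
  have lim: "filterlim ls at_top sequentially"
  proof (rule filterlim_at_top_mono)
    show "filterlim (\<lambda>n. real n) at_top sequentially"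
      by (rule filterlim_real_sequentially)
    have "real n \<le> ls n" for n
    proof -
      have "x n * 1 \<le> x n * iter_ln J (x n)"
        using iter_ln_ge[OF order.refl x[of n]] x[of n] x0_ge by (intro mult_left_mono) auto
      moreover have "real n \<le> x n"
        using x0_ge by (simp add: x_def)
      ultimately have "real n \<le> x n * iter_ln J (x n)"
        by linarith
      also have "\<dots> \<le> exp (x n * iter_ln J (x n))"
        using exp_ge_add_one_self[of "x n * iter_ln J (x n)"] by linarith
      finally show ?thesis
        by (simp add: ls)
    qed
    then show "\<forall>\<^sub>F n in sequentially. real n \<le> ls n"
      by simp
  qed
  have "\<forall>\<^sub>F n in sequentially. nat \<lceil>x0 + 6\<rceil> \<le> n"
    by (rule eventually_ge_at_top)
  then have "\<forall>\<^sub>F n in sequentially.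
      1 / 2 * (ln (ls n) / (ln ^^ k) (ls n)) \<le> cmod (SW_integral flat_phase (ls n)) \<and>
      cmod (SW_integral flat_phase (ls n)) \<le> 4 * (ln (ls n) / (ln ^^ k) (ls n))"
  proof eventually_elim
    case (elim n)
    then have n: "x0 + 6 \<le> real n"
      by linarith
    show ?case
    proof
      show "1 / 2 * (ln (ls n) / (ln ^^ k) (ls n)) \<le> cmod (SW_integral flat_phase (ls n))"
        using ratio(2)[of n] SW(1)[of n] n by (simp add: x_def)
      show "cmod (SW_integral flat_phase (ls n)) \<le> 4 * (ln (ls n) / (ln ^^ k) (ls n))"
        using ratio(1)[of n] SW(2)[of n] n x0_ge by (simp add: x_def)
    qed
  qed
  moreover have "0 < ls n" for n
    by (simp add: ls)
  ultimately show ?thesis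
    using smooth_flat_phase lim
    by (intro exI[of _ flat_phase] exI[of _ ls] conjI allI exI[of _ "1 / 2 :: real"] exI[of _ "4 :: real"]) auto
qed


theorem theorem1p2:
  shows "(\<forall>\<psi> :: real \<Rightarrow> real. smooth_on_I \<psi> \<longrightarrow>
           SW_integral \<psi> \<in> o[at_top](\<lambda>l. complex_of_real (ln l)))
       \<and> (\<forall>k :: nat. 2 \<le> k \<longrightarrow>
           (\<exists>(\<psi> :: real \<Rightarrow> real) (ls :: nat \<Rightarrow> real).
              smooth_on_I \<psi> \<and> (\<forall>n. 0 < ls n) \<and> filterlim ls at_top sequentially \<and>
              (\<exists>c C. 0 < c \<and> 0 < C \<and>
                (\<forall>\<^sub>F n in sequentially.
                   c * (ln (ls n) / (ln ^^ k) (ls n)) \<le> cmod (SW_integral \<psi> (ls n)) \<and>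
                   cmod (SW_integral \<psi> (ls n)) \<le> C * (ln (ls n) / (ln ^^ k) (ls n))))))"
  using SW_integral_smallo_ln SW_integral_sharp by blast

end
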